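(* There exist an absolute constant $c>0$ and an integer $d_0$ such that for every integer $d\ge d_0$ and every real $\alpha$ with $7\sqrt d<\alpha<d$, there exist infinitely many (in particular, with arbitrarily many vertices) $(d,\alpha)$-jumbled graphs $G$ whose second largest adjacency eigenvalue $\lambda_2(G)$ satisfies $\lambda_2(G)\ge c\,\alpha(\log(d/\alpha)+1)$.
   Context: A $d$-regular graph $G$ on $n$ vertices with adjacency matrix $M$ is $(d,\alpha)$-jumbled if for every two subsets of vertices $A,B$, $|e(A,B)-d|A||B|/n|\le\alpha\sqrt{|A||B|}$, where $e(A,B)=\mathbf 1_A^{t}M\mathbf 1_B$ counts the edges between $A$ and $B$. $\lambda_2(G)$ is the second largest eigenvalue of $M$. $\log$ denotes the natural logarithm. The $\Omega(\cdot)$ of the paper's statement is rendered with an explicit constant. *)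

theory Defs
  imports
    Complex_Main
    "Jordan_Normal_Form.Char_Poly"
    "Graph_Theory.Pair_Digraph"
begin

text \<open>
  Finite simple undirected graphs are rendered by \<open>pair_graph\<close> (finite, symmetric, loop-free, no
  parallel arcs). To index matrices, the vertex set of a graph on \<open>n\<close> vertices is \<open>{0..<n}\<close>.
\<close>

definition graph_on :: "nat \<Rightarrow> nat pair_pre_digraph \<Rightarrow> bool" where
  "graph_on n G \<longleftrightarrow> pair_graph G \<and> pverts G = {0..<n}"

definition regular_graph_on :: "nat \<Rightarrow> nat \<Rightarrow> nat pair_pre_digraph \<Rightarrow> bool" where
  "regular_graph_on n d G \<longleftrightarrow> graph_on n G \<and> (\<forall>v \<in> pverts G. out_degree (with_proj G) v = d)"

definition adjacency_matrix :: "nat \<Rightarrow> nat pair_pre_digraph \<Rightarrow> real mat" where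
  "adjacency_matrix n G = mat n n (\<lambda>(i, j). if (i, j) \<in> parcs G then 1 else 0)"

definition indicator_vec :: "nat \<Rightarrow> nat set \<Rightarrow> real vec" where
  "indicator_vec n A = vec n (\<lambda>i. if i \<in> A then 1 else 0)"

text \<open>Edges with both endpoints in \<open>A \<inter> B\<close> are counted twice.\<close>

definition edge_count :: "nat \<Rightarrow> nat pair_pre_digraph \<Rightarrow> nat set \<Rightarrow> nat set \<Rightarrow> real" where
  "edge_count n G A B = indicator_vec n A \<bullet> (adjacency_matrix n G *\<^sub>v indicator_vec n B)"

definition jumbled :: "nat \<Rightarrow> nat \<Rightarrow> real \<Rightarrow> nat pair_pre_digraph \<Rightarrow> bool" where
  "jumbled n d \<alpha> G \<longleftrightarrow> regular_graph_on n d G \<and>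
     (\<forall>A B. A \<subseteq> pverts G \<longrightarrow> B \<subseteq> pverts G \<longrightarrow>
        \<bar>edge_count n G A B - real d * real (card A) * real (card B) / real n\<bar>
          \<le> \<alpha> * sqrt (real (card A) * real (card B)))"

text \<open>
  Eigenvalues are listed in decreasing order with multiplicity, so \<open>\<lambda>\<^sub>2\<close> equals \<open>\<lambda>\<^sub>1\<close> when the largest
  eigenvalue is not simple. A real symmetric \<open>n \<times> n\<close> matrix has \<open>n\<close> real eigenvalues, so for an
  adjacency matrix the list has length \<open>n\<close>; the value of \<open>second_eigenvalue\<close> is meaningful for
  \<open>n \<ge> 2\<close>.
\<close>

definition eigenvalues_desc :: "real mat \<Rightarrow> real list" where
  "eigenvalues_desc M = rev (sorted_list_of_multiset (proots (char_poly M)))"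

definition second_eigenvalue :: "nat \<Rightarrow> nat pair_pre_digraph \<Rightarrow> real" where
  "second_eigenvalue n G = eigenvalues_desc (adjacency_matrix n G) ! 1"

end

theory Submission
  imports Defs "HOL-Library.FuncSet" "HOL-Combinatorics.Transposition"
begin

text \<open>
  The vertices are split into fibres \<open>x\<close> of equal size carrying a sign and a level \<open>lev x \<le> s\<close>, with
  \<open>2 * 4 ^ (s - i)\<close> fibres of level \<open>i\<close> and \<open>4 ^ s\<close> of order \<open>d / \<alpha>\<close>. Each vertex of \<open>x\<close> gets exactly
  \<open>t + K * g x * g y\<close> neighbours in \<open>y\<close> (and \<open>r\<close> more if \<open>x = y\<close>), where \<open>g x\<close> is \<open>2 ^ lev x\<close> with the sign
  of \<open>x\<close>. The signs cancel in the row sums, so the graph is regular, and \<open>g\<close> is an exact eigenvector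
  whose eigenvalue is at least \<open>K\<close> times the sum of \<open>4 ^ lev x\<close>: every level contributes \<open>2 * K * 4 ^ s\<close>,
  which is of order \<open>\<alpha>\<close>, and there are \<open>s + 1\<close> levels. The discrepancy caused by the rank-one term
  is a product of two sums of \<open>2 ^ lev\<close>, of order \<open>K * 4 ^ s * sqrt (card A * card B)\<close> without the factor
  \<open>s + 1\<close>; this gap is the logarithm.

  The actual edges form independent uniformly random perfect matchings between small cells of the
  fibres. For a random matching, the number of arcs between two sets has a moment generating function
  bounded by that of a Poisson variable, and a union bound over all pairs of sets of comparable size
  gives deviation at most \<open>6 * sqrt d * sqrt (card A * card B)\<close>; for unbalanced pairs this is trivial.
\<close>

section \<open>Random perfect matchings\<close>

text \<open>Extensionality fixes the values outside \<open>P\<close>, so each perfect matching is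
  one element, the set is finite, and normalised sums over it are expectations for a uniformly
  random matching.\<close>

definition bijections :: "'a set \<Rightarrow> 'b set \<Rightarrow> ('a \<Rightarrow> 'b) set" where
  "bijections P Q = {\<sigma> \<in> P \<rightarrow>\<^sub>E Q. bij_betw \<sigma> P Q}"

lemma finite_bijections [simp]: "finite P \<Longrightarrow> finite Q \<Longrightarrow> finite (bijections P Q)"
  unfolding bijections_def by (rule finite_subset[of _ "P \<rightarrow>\<^sub>E Q"]) (auto intro: finite_PiE)

lemma bijections_nonempty:
  assumes "finite P" "finite Q" "card P = card Q"
  shows "bijections P Q \<noteq> {}"
proof -
  obtain h where h: "bij_betw h P Q" using finite_same_card_bij[OF assms] by blast
  hence "bij_betw (restrict h P) P Q" by (simp add: bij_betw_restrict_eq)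
  moreover have "restrict h P \<in> P \<rightarrow>\<^sub>E Q" using h by (auto simp: bij_betw_def)
  ultimately show ?thesis unfolding bijections_def by blast
qed

lemma bijections_transpose:
  assumes "\<sigma> \<in> bijections P Q" "x \<in> P" "y \<in> P"
  shows "\<sigma> \<circ> transpose x y \<in> bijections P Q"
proof -
  have "bij_betw (transpose x y) P P"
    using assms by (simp add: bij_betw_def)
  with assms have "bij_betw (\<sigma> \<circ> transpose x y) P Q"
    unfolding bijections_def by (metis (no_types, lifting) bij_betw_trans mem_Collect_eq)
  moreover have "\<sigma> \<circ> transpose x y \<in> P \<rightarrow>\<^sub>E Q"
    using assms by (auto simp: bijections_def transpose_def PiE_def extensional_def)
  ultimately show ?thesis by (simp add: bijections_def)
qed

text \<open>Precomposing with a transposition is an involution of the set of bijections. This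
  expresses that the points of \<open>P\<close> are exchangeable.\<close>

lemma sum_bijections_transpose:
  assumes "x \<in> P" "y \<in> P"
  shows "(\<Sum>\<sigma>\<in>bijections P Q. h (\<sigma> \<circ> transpose x y)) = (\<Sum>\<sigma>\<in>bijections P Q. h \<sigma>)"
  by (rule sum.reindex_bij_witness[of _ "\<lambda>\<sigma>. \<sigma> \<circ> transpose x y" "\<lambda>\<sigma>. \<sigma> \<circ> transpose x y"])
    (use assms bijections_transpose in \<open>auto simp: comp_assoc\<close>)

lemma card_bijection_preimage:
  assumes "\<sigma> \<in> bijections P Q" "B \<subseteq> Q"
  shows "card {v \<in> P. \<sigma> v \<in> B} = card B"
proof -
  have "bij_betw \<sigma> {v \<in> P. \<sigma> v \<in> B} B"
    using assms unfolding bijections_def bij_betw_def inj_on_def by auto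
  thus ?thesis by (rule bij_betw_same_card)
qed

text \<open>By exchangeability all points of \<open>P\<close> hit \<open>B\<close> equally often,
  and \<open>P\<close> as a whole always scores \<open>card B\<close> hits. With the denominator
  cleared, empty \<open>P\<close> is covered too.\<close>

lemma sum_bijections_hits:
  assumes "finite P" "finite Q" "A \<subseteq> P" "B \<subseteq> Q"
  shows "real (card P) * (\<Sum>\<sigma>\<in>bijections P Q. real (card {v \<in> A. \<sigma> v \<in> B}))
    = real (card A) * real (card B) * real (card (bijections P Q))"
proof (cases "P = {}")
  case True
  with assms show ?thesis by auto
next
  case False
  then obtain x0 where x0: "x0 \<in> P" by blast
  let ?S = "bijections P Q"
  define G where "G x = (\<Sum>\<sigma>\<in>?S. if \<sigma> x \<in> B then 1 else (0::real))" for x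
  have fA: "finite A" using assms finite_subset by blast
  have eq: "G x = G x0" if "x \<in> P" for x
    using sum_bijections_transpose[OF x0 that, of "\<lambda>\<sigma>. if \<sigma> x0 \<in> B then 1 else (0::real)" Q]
    by (simp add: G_def)
  have tot: "(\<Sum>\<sigma>\<in>?S. real (card {v \<in> C. \<sigma> v \<in> B})) = real (card C) * G x0" if "C \<subseteq> P" for C
  proof -
    have fC: "finite C" using that assms finite_subset by blast
    have "(\<Sum>\<sigma>\<in>?S. real (card {v \<in> C. \<sigma> v \<in> B})) = (\<Sum>\<sigma>\<in>?S. \<Sum>v\<in>C. if \<sigma> v \<in> B then 1 else 0)"
      using fC by (simp add: sum.If_cases Int_def)
    also have "\<dots> = (\<Sum>v\<in>C. G v)" unfolding G_def by (rule sum.swap)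
    also have "\<dots> = (\<Sum>v\<in>C. G x0)" using eq that by (intro sum.cong) auto
    finally show ?thesis by simp
  qed
  have "(\<Sum>\<sigma>\<in>?S. real (card {v \<in> P. \<sigma> v \<in> B})) = (\<Sum>\<sigma>\<in>?S. real (card B))"
    using card_bijection_preimage assms by (intro sum.cong) auto
  hence "real (card P) * G x0 = real (card ?S) * real (card B)"
    using tot[of P] by simp
  thus ?thesis using tot[OF assms(3)] by (simp add: mult.commute mult.left_commute)
qed

text \<open>Pointwise form of Chebyshev's correlation inequality: \<open>k - c\<close> and
  \<open>z ^ k - z powr c\<close> agree in sign for \<open>z > 1\<close> and are opposite for
  \<open>z < 1\<close>, which the factor \<open>z - 1\<close> corrects. If \<open>c\<close> is the
  mean of \<open>k\<close>, the right-hand side averages to zero.\<close>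

lemma power_chebyshev:
  fixes z c :: real
  assumes "z > 0"
  shows "(z - 1) * (z ^ k * (real k - c)) \<ge> (z - 1) * (z powr c * (real k - c))"
proof -
  have zk: "z ^ k = z powr real k" using assms by (simp add: powr_realpow)
  have "(z - 1) * ((z powr real k - z powr c) * (real k - c)) \<ge> 0"
  proof (cases "z \<ge> 1")
    case True
    have "(z powr real k - z powr c) * (real k - c) \<ge> 0"
      using True powr_mono[of c "real k" z] powr_mono[of "real k" c z]
      by (cases "c \<le> real k") (auto simp: zero_le_mult_iff)
    thus ?thesis using True by simp
  next
    case False
    have "(z powr real k - z powr c) * (real k - c) \<le> 0"
      using False assms powr_mono'[of c "real k" z] powr_mono'[of "real k" c z]
      by (cases "c \<le> real k") (auto simp: mult_le_0_iff)
    thus ?thesis using False by (simp add: mult_nonpos_nonpos)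
  qed
  thus ?thesis by (simp add: zk algebra_simps)
qed

text \<open>Adding a point \<open>x\<close> to \<open>A\<close> is averaged over all \<open>x\<close> outside \<open>A\<close>, by symmetry. The error term has the right
  sign because \<open>z ^ k\<close> is positively correlated with \<open>k\<close> for \<open>z > 1\<close> and negatively for \<open>z < 1\<close>, so one
  argument serves both tails.\<close>

lemma hits_mgf_aux:
  fixes z :: real
  assumes fin: "finite P" "finite Q" and card: "card P = card Q" and z: "z > 0"
    and B: "B \<subseteq> Q" and A: "A \<subseteq> P"
  shows "(\<Sum>\<sigma>\<in>bijections P Q. z ^ card {v \<in> A. \<sigma> v \<in> B})
    \<le> real (card (bijections P Q)) * (1 + (z - 1) * real (card B) / real (card P)) ^ card A"
proof -
  have "finite A" using A fin finite_subset by blast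
  thus ?thesis using A
  proof (induction A rule: finite_induct)
    case empty
    show ?case by simp
  next
    case (insert x A)
    let ?S = "bijections P Q"
    define n where "n = real (card P)"
    define a where "a = real (card A)"
    define b where "b = real (card B)"
    define k where "k \<sigma> = card {v \<in> A. \<sigma> v \<in> B}" for \<sigma> :: "'a \<Rightarrow> 'b"
    define F where "F A = (\<Sum>\<sigma>\<in>?S. z ^ card {v \<in> A. \<sigma> v \<in> B})" for A
    have AP: "A \<subseteq> P" and xP: "x \<in> P" using insert by auto
    have "card (insert x A) \<le> card P" using insert fin by (intro card_mono) auto
    hence an: "a < n" and n0: "n > 0" using insert by (auto simp: a_def n_def)
    have bn: "b \<le> n" using B fin card by (auto simp: b_def n_def intro!: card_mono)
    have FA: "F A = (\<Sum>\<sigma>\<in>?S. z ^ k \<sigma>)" by (simp add: F_def k_def)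
    have ins: "z ^ card {v \<in> insert y A. \<sigma> v \<in> B} = z ^ k \<sigma> * (if \<sigma> y \<in> B then z else 1)"
      if "y \<notin> A" for y \<sigma>
    proof -
      have "{v \<in> insert y A. \<sigma> v \<in> B} = (if \<sigma> y \<in> B then insert y {v \<in> A. \<sigma> v \<in> B} else {v \<in> A. \<sigma> v \<in> B})"
        by auto
      thus ?thesis using that insert by (simp add: k_def)
    qed
    have symm: "F (insert y A) = F (insert x A)" if "y \<in> P - A" for y
    proof -
      have "card {v \<in> insert x A. (\<sigma> \<circ> transpose x y) v \<in> B} = card {v \<in> insert y A. \<sigma> v \<in> B}" for \<sigma>
      proof (rule bij_betw_same_card[of "transpose x y"])
        show "bij_betw (transpose x y) {v \<in> insert x A. (\<sigma> \<circ> transpose x y) v \<in> B} {v \<in> insert y A. \<sigma> v \<in> B}"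
          by (rule bij_betw_byWitness[of _ "transpose x y"]) (use that insert in \<open>auto simp: transpose_def\<close>)
      qed
      thus ?thesis
        unfolding F_def using sum_bijections_transpose[of x P y "\<lambda>\<sigma>. z ^ card {v \<in> insert x A. \<sigma> v \<in> B}" Q] xP that
        by simp
    qed
    \<comment> \<open>Every point of \<open>B\<close> has exactly one preimage, so
      \<open>b - k \<sigma>\<close> points outside \<open>A\<close> hit \<open>B\<close>.\<close>
    have miss: "(\<Sum>y\<in>P - A. if \<sigma> y \<in> B then z else 1) = (n - a) + (z - 1) * (b - real (k \<sigma>))"
      if "\<sigma> \<in> ?S" for \<sigma>
    proof -
      have fPA: "finite (P - A)" using fin by simp
      have c1: "card {v \<in> P. \<sigma> v \<in> B} = card {v \<in> P - A. \<sigma> v \<in> B} + k \<sigma>"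
        unfolding k_def using fin insert
        by (subst card_Un_disjoint[symmetric]) (auto intro!: arg_cong[where f = card])
      have "(\<Sum>y\<in>P - A. if \<sigma> y \<in> B then z else 1) = (\<Sum>y\<in>P - A. 1 + (z - 1) * (if \<sigma> y \<in> B then 1 else 0))"
        by (intro sum.cong) auto
      also have "\<dots> = real (card (P - A)) + (z - 1) * real (card {v \<in> P - A. \<sigma> v \<in> B})"
        using fPA by (simp add: sum.distrib sum_distrib_left[symmetric] sum.If_cases Int_def)
      also have "real (card (P - A)) = n - a"
        using fin AP by (simp add: card_Diff_subset finite_subset n_def a_def of_nat_diff card_mono)
      also have "real (card {v \<in> P - A. \<sigma> v \<in> B}) = b - real (k \<sigma>)"
        using c1 card_bijection_preimage[OF that B] by (simp add: b_def)
      finally show ?thesis .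
    qed
    have "(n - a) * F (insert x A) = (\<Sum>y\<in>P - A. F (insert y A))"
      using symm fin AP by (simp add: card_Diff_subset finite_subset n_def a_def of_nat_diff card_mono)
    also have "\<dots> = (\<Sum>\<sigma>\<in>?S. \<Sum>y\<in>P - A. z ^ k \<sigma> * (if \<sigma> y \<in> B then z else 1))"
      unfolding F_def by (subst sum.swap) (intro sum.cong refl ins, auto)
    also have "\<dots> = (\<Sum>\<sigma>\<in>?S. z ^ k \<sigma> * ((n - a) + (z - 1) * (b - real (k \<sigma>))))"
      using miss by (intro sum.cong) (simp_all add: sum_distrib_left[symmetric])
    \<comment> \<open>Here \<open>k \<sigma>\<close> is replaced by its mean
      \<open>a * b / n\<close>. The subtracted term sums to zero, and
      \<open>b - a * b / n = (n - a) * b / n\<close> lets the factor \<open>n - a\<close>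
      cancel.\<close>
    also have "\<dots> \<le> (\<Sum>\<sigma>\<in>?S. z ^ k \<sigma> * ((n - a) + (z - 1) * (b - a * b / n))
        - (z - 1) * (z powr (a * b / n) * (real (k \<sigma>) - a * b / n)))"
    proof (rule sum_mono)
      fix \<sigma>
      show "z ^ k \<sigma> * ((n - a) + (z - 1) * (b - real (k \<sigma>)))
        \<le> z ^ k \<sigma> * ((n - a) + (z - 1) * (b - a * b / n))
        - (z - 1) * (z powr (a * b / n) * (real (k \<sigma>) - a * b / n))"
        using power_chebyshev[OF z, of "a * b / n" "k \<sigma>"] by (simp add: algebra_simps)
    qed
    also have "\<dots> = (\<Sum>\<sigma>\<in>?S. ((n - a) + (z - 1) * (b - a * b / n)) * z ^ k \<sigma>)
        - (\<Sum>\<sigma>\<in>?S. ((z - 1) * z powr (a * b / n)) * (real (k \<sigma>) - a * b / n))"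
      by (simp add: sum_subtractf mult_ac)
    also have "\<dots> = F A * ((n - a) + (z - 1) * (b - a * b / n))
        - (z - 1) * z powr (a * b / n) * ((\<Sum>\<sigma>\<in>?S. real (k \<sigma>)) - real (card ?S) * (a * b / n))"
      unfolding FA sum_distrib_left[symmetric] sum_subtractf[of _ "\<lambda>_. _"] by (simp add: mult.commute)
    also have "(\<Sum>\<sigma>\<in>?S. real (k \<sigma>)) = real (card ?S) * (a * b / n)"
      using sum_bijections_hits[OF fin AP B] n0 by (simp add: k_def n_def a_def b_def field_simps)
    also have "F A * ((n - a) + (z - 1) * (b - a * b / n)) - (z - 1) * z powr (a * b / n) *
        (real (card ?S) * (a * b / n) - real (card ?S) * (a * b / n)) = (n - a) * (F A * (1 + (z - 1) * b / n))"
      using n0 by (simp add: field_simps)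
    finally have "F (insert x A) \<le> F A * (1 + (z - 1) * b / n)"
      using an by simp
    also have "\<dots> \<le> real (card ?S) * (1 + (z - 1) * b / n) ^ card A * (1 + (z - 1) * b / n)"
    proof (rule mult_right_mono)
      show "F A \<le> real (card ?S) * (1 + (z - 1) * b / n) ^ card A"
        using insert AP by (simp add: F_def b_def n_def)
      have "0 \<le> z * b" using z by (simp add: b_def)
      hence "(1 - z) * b \<le> n" using bn by (simp add: algebra_simps)
      thus "0 \<le> 1 + (z - 1) * b / n" using n0 by (simp add: field_simps)
    qed
    finally show ?case using insert by (simp add: F_def b_def n_def mult_ac)
  qed
qed

text \<open>The inequality \<open>1 + q \<le> exp q\<close> passes to the Poisson form, whose
  exponent is linear in the mean; bounds for independent matchings then multiply while their means
  add.\<close>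

lemma hits_mgf:
  fixes z :: real
  assumes fin: "finite P" "finite Q" and card: "card P = card Q" and z: "z > 0"
    and B: "B \<subseteq> Q" and A: "A \<subseteq> P"
  shows "(\<Sum>\<sigma>\<in>bijections P Q. z ^ card {v \<in> A. \<sigma> v \<in> B})
    \<le> real (card (bijections P Q)) * exp ((z - 1) * (real (card A) * real (card B) / real (card P)))"
proof -
  define q where "q = (z - 1) * real (card B) / real (card P)"
  have "1 + q \<ge> 0"
  \<comment> \<open>If \<open>P\<close> is empty, division by zero gives
    \<open>q = 0\<close>.\<close>
  proof (cases "card P = 0")
    case False
    have "card B \<le> card P" using B fin card by (auto intro!: card_mono)
    moreover have "0 \<le> z * real (card B)" using z by simp
    ultimately have "(1 - z) * real (card B) \<le> real (card P)" by (simp add: algebra_simps)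
    thus ?thesis using False by (simp add: q_def field_simps)
  qed (simp add: q_def)
  hence "(1 + q) ^ card A \<le> exp q ^ card A"
    by (intro power_mono exp_ge_add_one_self) auto
  also have "\<dots> = exp (real (card A) * q)" by (simp add: exp_of_nat_mult)
  finally have "real (card (bijections P Q)) * (1 + q) ^ card A
      \<le> real (card (bijections P Q)) * exp (real (card A) * q)"
    by (intro mult_left_mono) auto
  thus ?thesis using hits_mgf_aux[OF assms] by (simp add: q_def mult_ac)
qed

section \<open>Tail estimates\<close>

text \<open>The difference of the two sides has derivative
  \<open>(exp (x/2) - exp (-(x/2)))^2\<close>. It reduces the lower-tail exponent to the upper-tail
  one.\<close>

lemma exp_minus_convex_le:
  fixes l :: real
  assumes "l \<ge> 0"
  shows "exp (- l) - 1 + l \<le> exp l - 1 - l"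
proof -
  define h where "h x = exp x - exp (- x) - 2 * x" for x :: real
  have "h 0 \<le> h l"
  proof (rule DERIV_nonneg_imp_nondecreasing[OF assms])
    fix x :: real assume "0 \<le> x"
    have "0 \<le> (exp (x/2) - exp (-(x/2)))^2" by simp
    also have "\<dots> = exp x + exp (-x) - 2"
      by (simp add: power2_eq_square algebra_simps exp_add[symmetric])
    finally have "0 \<le> exp x + exp (-x) - 2" .
    moreover have "(h has_real_derivative (exp x + exp (-x) - 2)) (at x)"
      unfolding h_def by (auto intro!: derivative_eq_intros)
    ultimately show "\<exists>y. (h has_real_derivative y) (at x) \<and> 0 \<le> y" by blast
  qed
  thus ?thesis by (simp add: h_def)
qed

text \<open>The derivative in \<open>z\<close> is \<open>ln (N / z)\<close>, nonnegative up to
  \<open>N\<close>; \<open>ln x \<le> x - 1\<close> replaces differentiation. The entropy at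
  \<open>b\<close> can thus be estimated at a more convenient larger point.\<close>

lemma entropy_mono:
  fixes b z N :: real
  assumes "0 < b" "b \<le> z" "z \<le> N"
  shows "b * (1 + ln (N / b)) \<le> z * (1 + ln (N / z))"
proof -
  have pos: "0 < z" "0 < N" using assms by auto
  have "ln (N / b) = ln (N / z) + ln (z / b)" using assms pos by (simp add: ln_div)
  moreover have "b * ln (z / b) \<le> b * (z / b - 1)"
    using assms pos by (intro mult_left_mono ln_le_minus_one) auto
  ultimately have "b * (1 + ln (N / b)) \<le> b * (1 + ln (N / z)) + b * (z / b - 1)"
    by (simp add: distrib_left)
  also have "b * (z / b - 1) = (z - b) * 1" using assms by (simp add: field_simps)
  also have "(z - b) * 1 \<le> (z - b) * (1 + ln (N / z))"
    using assms pos by (intro mult_left_mono) auto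
  finally show ?thesis by (simp add: algebra_simps)
qed

lemma exp_1_le: "exp (1::real) \<le> 2.76"
proof -
  have "exp (1::real) = exp (1/32) ^ 32" by (simp add: exp_of_nat_mult[symmetric])
  also have "\<dots> \<le> (1 + 1/32 + (1/32)\<^sup>2) ^ 32" by (intro power_mono exp_bound) auto
  also have "\<dots> \<le> 2.76" by (simp add: power_divide power2_eq_square)
  finally show ?thesis .
qed

text \<open>The Chernoff exponent at deviation \<open>6 * y\<close> beats twice the entropy of a pair of sets of size at most \<open>b\<close>.
  Large \<open>y\<close> is the Gaussian regime, small \<open>y\<close> the Poisson regime.\<close>

lemma chernoff_exponent:
  fixes y b N :: real
  assumes b: "0 < b" "b \<le> N" "6 * b \<le> y"
  obtains l where "l \<ge> 0"
    "3 * l * y - 11/20 * (y\<^sup>2 / N) * (exp l - 1 - l) \<ge> 4 * b * (1 + ln (N / b))"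
proof -
  have N: "N > 0" and y: "y > 0" using b by auto
  consider "y \<ge> 27/10 * N" | "N \<le> y" "y < 27/10 * N" | "y < N" by linarith
  thus ?thesis
  proof cases
    case 1
    \<comment> \<open>With \<open>exp l - 1 - l\<close> bounded by the square of \<open>l\<close>,
      the optimum is \<open>30/11 * N / y\<close>, rounded here so that the case condition says
      \<open>l \<le> 1\<close>. The gain is about \<open>4.09 * N\<close>, against the maximal
      entropy \<open>4 * N\<close>.\<close>
    define l where "l = 27/10 * N / y"
    have l: "0 \<le> l" "l \<le> 1" using 1 N y by (auto simp: l_def field_simps)
    have "exp l - 1 - l \<le> l\<^sup>2" using exp_bound[OF l] by simp
    hence "11/20 * (y\<^sup>2 / N) * (exp l - 1 - l) \<le> 11/20 * (y\<^sup>2 / N) * l\<^sup>2"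
      using N by (intro mult_left_mono) auto
    also have "\<dots> = 11/20 * (27/10)^2 * N" using N y by (simp add: l_def power2_eq_square field_simps)
    finally have "3 * l * y - 11/20 * (y\<^sup>2 / N) * (exp l - 1 - l) \<ge> 3 * l * y - 11/20 * (27/10)^2 * N"
      by simp
    moreover have "3 * l * y = 81/10 * N" using y by (simp add: l_def)
    moreover have "4 * (b * (1 + ln (N / b))) \<le> 4 * N" using entropy_mono[of b N N] b N by simp
    ultimately have "3 * l * y - 11/20 * (y\<^sup>2 / N) * (exp l - 1 - l) \<ge> 4 * b * (1 + ln (N / b))"
      using N by (simp add: power2_eq_square)
    with l that show ?thesis by blast
  next
    case 2
    have "y\<^sup>2 / N \<le> 27/10 * y" using 2 N y by (simp add: power2_eq_square field_simps)
    moreover have "exp (1::real) - 1 - 1 \<le> 19/25" "0 \<le> exp (1::real) - 1 - 1"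
      using exp_1_le exp_ge_add_one_self[of 1] by auto
    ultimately have "(y\<^sup>2 / N) * (exp 1 - 1 - 1) \<le> (27/10 * y) * (19/25)"
      using y N by (intro mult_mono) auto
    hence 3: "3 * 1 * y - 11/20 * (y\<^sup>2 / N) * (exp 1 - 1 - 1) \<ge> (187/100) * y"
      using y by simp
    \<comment> \<open>The entropy is evaluated at the largest admissible size \<open>y / 6\<close>.
      With \<open>ln 6 \<le> 1.8\<close> it comes to \<open>28/15 * y\<close>, just below
      \<open>1.87 * y\<close>.\<close>
    have "4 * (b * (1 + ln (N / b))) \<le> 4 * (y / 6 * (1 + ln (N / (y / 6))))"
      using entropy_mono[of b "y / 6" N] b 2 N by simp
    also have "ln (N / (y / 6)) \<le> ln 6"
      using 2 N y by (subst ln_le_cancel_iff) (auto simp: field_simps)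
    also have "ln (6::real) \<le> 1.8"
    proof -
      have "(6::real) \<le> (1 + 1/10 + (1/10)\<^sup>2/2)^18" by (simp add: power_divide power2_eq_square)
      also have "\<dots> \<le> exp (1/10) ^ 18"
        using exp_lower_Taylor_quadratic[of "1/10"] by (intro power_mono) auto
      also have "\<dots> = exp (1.8::real)" by (simp add: exp_of_nat_mult[symmetric])
      finally show ?thesis using ln_le_cancel_iff[of 6 "exp 1.8"] by simp
    qed
    finally have "4 * (b * (1 + ln (N / b))) \<le> (187/100) * y" using y by simp
    with 3 have "4 * b * (1 + ln (N / b)) \<le> 3 * 1 * y - 11/20 * (y\<^sup>2 / N) * (exp 1 - 1 - 1)"
      unfolding mult.assoc[of 4] by (rule order_trans[rotated])
    thus ?thesis by (intro that[of 1]) auto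
  next
    case 3
    \<comment> \<open>This choice makes the entropy at \<open>y / 6\<close> equal to
      \<open>y / 6 * (1 + l)\<close> and the exponential term equal to \<open>6 * y\<close>. What
      remains, \<open>3 * l - 33/10 \<ge> 2/3 * (1 + l)\<close>, holds exactly from
      \<open>l = 1.7\<close> on, and \<open>y < N\<close> ensures that.\<close>
    define l where "l = ln (6 * N / y)"
    have e: "exp l = 6 * N / y" using N y by (simp add: l_def)
    have "exp (1.7::real) \<le> 6"
    proof -
      have "exp (1.7::real) = exp (17/320) ^ 32" by (simp add: exp_of_nat_mult[symmetric])
      also have "\<dots> \<le> (1 + 17/320 + (17/320)\<^sup>2) ^ 32" by (intro power_mono exp_bound) auto
      also have "\<dots> \<le> 6" by (simp add: power_divide power2_eq_square)
      finally show ?thesis .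
    qed
    also have "6 \<le> 6 * N / y" using 3 y by (simp add: field_simps)
    finally have l: "l \<ge> 1.7" unfolding l_def using N y by (subst ln_ge_iff) auto
    have "(y\<^sup>2 / N) * (exp l - 1 - l) \<le> (y\<^sup>2 / N) * (6 * N / y)"
      using l N e by (intro mult_left_mono) auto
    also have "\<dots> = 6 * y" using N y by (simp add: power2_eq_square)
    finally have "11/20 * (y\<^sup>2 / N) * (exp l - 1 - l) \<le> 33/10 * y" by simp
    hence 4: "3 * l * y - 11/20 * (y\<^sup>2 / N) * (exp l - 1 - l) \<ge> (3 * l - 33/10) * y"
      unfolding left_diff_distrib[of "3 * l"] by linarith
    have "4 * (b * (1 + ln (N / b))) \<le> 4 * (y / 6 * (1 + ln (N / (y / 6))))"
      using entropy_mono[of b "y / 6" N] b 3 N by simp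
    also have "\<dots> = 2/3 * (1 + l) * y" by (simp add: l_def mult.commute)
    also have "\<dots> \<le> (3 * l - 33/10) * y" using l y by (intro mult_right_mono) auto
    finally have "4 * b * (1 + ln (N / b)) \<le> 3 * l * y - 11/20 * (y\<^sup>2 / N) * (exp l - 1 - l)"
      using 4 unfolding mult.assoc[of 4] by (rule order_trans)
    with l show ?thesis by (intro that[of l]) auto
  qed
qed

text \<open>The weight \<open>q ^ (b - i)\<close> is at least 1 for \<open>i \<le> b\<close>.
  Extending the weighted sum to all \<open>i \<le> N\<close> gives
  \<open>q ^ b * (1 + 1 / q) ^ N\<close> by the binomial theorem, and
  \<open>N / q = b\<close>.\<close>

lemma card_small_subsets_le:
  assumes "1 \<le> b" "b \<le> N"
  shows "real (\<Sum>i\<le>b. N choose i) \<le> (exp 1 * real N / real b) ^ b"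
proof -
  define q where "q = real N / real b"
  have q: "q \<ge> 1" "q > 0" using assms by (auto simp: q_def)
  have "real (\<Sum>i\<le>b. N choose i) = (\<Sum>i\<le>b. real (N choose i) * 1)" by simp
  also have "\<dots> \<le> (\<Sum>i\<le>b. real (N choose i) * (q ^ b * (1 / q) ^ i))"
  proof (intro sum_mono mult_left_mono)
    fix i assume i: "i \<in> {..b}"
    hence "q ^ b * (1 / q) ^ i = q ^ (b - i)" using q by (simp add: power_diff power_one_over field_simps)
    thus "1 \<le> q ^ b * (1 / q) ^ i" using q by simp
  qed auto
  also have "\<dots> \<le> (\<Sum>i\<le>N. real (N choose i) * (q ^ b * (1 / q) ^ i))"
    using assms q by (intro sum_mono2) auto
  also have "\<dots> = q ^ b * (1 / q + 1) ^ N"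
    by (subst binomial_ring) (simp add: sum_distrib_left mult_ac)
  also have "\<dots> \<le> q ^ b * exp (1 / q) ^ N"
    using q by (intro mult_left_mono power_mono) (auto simp: add.commute)
  also have "exp (1 / q) ^ N = exp 1 ^ b"
    using assms q by (simp add: exp_of_nat_mult[symmetric] q_def)
  finally show ?thesis by (simp add: q_def power_mult_distrib[symmetric] mult.commute)
qed

lemma card_subsets_card_le:
  assumes "1 \<le> b" "b \<le> N"
  shows "real (card {A. A \<subseteq> {0..<N} \<and> card A \<le> b}) \<le> (exp 1 * real N / real b) ^ b"
proof -
  have "{A. A \<subseteq> {0..<N} \<and> card A \<le> b} = (\<Union>i\<le>b. {A. A \<subseteq> {0..<N} \<and> card A = i})" by auto
  also have "card \<dots> \<le> (\<Sum>i\<le>b. card {A. A \<subseteq> {0..<N} \<and> card A = i})"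
    by (rule card_UN_le) auto
  also have "\<dots> = (\<Sum>i\<le>b. N choose i)" by (simp add: n_subsets)
  finally have "real (card {A. A \<subseteq> {0..<N} \<and> card A \<le> b}) \<le> real (\<Sum>i\<le>b. N choose i)"
    by (simp only: of_nat_le_iff)
  thus ?thesis using card_small_subsets_le[OF assms] by linarith
qed

text \<open>The empty set and the singletons already number \<open>N + 1\<close>. This makes the
  failure probabilities small enough to be summed over all sizes \<open>b\<close>.\<close>

lemma Suc_le_entropy_power:
  assumes "1 \<le> b" "b \<le> N"
  shows "real N + 1 \<le> (exp 1 * real N / real b) ^ b"
proof -
  have "(\<Sum>i\<in>{0,1}. N choose i) \<le> (\<Sum>i\<le>b. N choose i)"
    using assms by (intro sum_mono2) auto
  hence "real N + 1 \<le> real (\<Sum>i\<le>b. N choose i)" by (simp add: of_nat_le_iff[symmetric, where 'a=real] del: of_nat_le_iff)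
  thus ?thesis using card_small_subsets_le[OF assms] by linarith
qed

lemma markov_exp:
  fixes f :: "'a \<Rightarrow> real"
  assumes "finite S" "(\<Sum>\<omega>\<in>S. exp (f \<omega>)) \<le> real (card S) * exp r"
  shows "real (card {\<omega> \<in> S. f \<omega> > t}) \<le> real (card S) * exp (r - t)"
proof -
  have "real (card {\<omega> \<in> S. f \<omega> > t}) * exp t = (\<Sum>\<omega>\<in>{\<omega> \<in> S. f \<omega> > t}. exp t)" by simp
  also have "\<dots> \<le> (\<Sum>\<omega>\<in>{\<omega> \<in> S. f \<omega> > t}. exp (f \<omega>))" by (intro sum_mono) auto
  also have "\<dots> \<le> (\<Sum>\<omega>\<in>S. exp (f \<omega>))" using assms by (intro sum_mono2) auto
  also have "\<dots> \<le> real (card S) * exp r" by (rule assms)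
  finally show ?thesis by (simp add: exp_diff field_simps)
qed

section \<open>Graphs composed of random matchings\<close>

definition joins :: "('e \<Rightarrow> 'v set) \<Rightarrow> ('e \<Rightarrow> 'v set) \<Rightarrow> 'e \<Rightarrow> 'v \<Rightarrow> 'v \<Rightarrow> bool" where
  "joins P Q e u v \<longleftrightarrow> (u \<in> P e \<and> v \<in> Q e) \<or> (u \<in> Q e \<and> v \<in> P e)"

text \<open>Each \<open>e\<close> is a slot for one matching between \<open>P e\<close> and
  \<open>Q e\<close>. By \<open>joins_unique\<close> no pair of vertices can be matched in two
  slots, so the union of the matchings is simple and arc indicators add up without overlap.\<close>

locale random_matchings =
  fixes N :: nat and E :: "'e set" and P Q :: "'e \<Rightarrow> nat set"
  assumes finE: "finite E"
    and PV: "e \<in> E \<Longrightarrow> P e \<subseteq> {0..<N}"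
    and QV: "e \<in> E \<Longrightarrow> Q e \<subseteq> {0..<N}"
    and card_PQ: "e \<in> E \<Longrightarrow> card (P e) = card (Q e)"
    and PQ_disjoint: "e \<in> E \<Longrightarrow> P e \<inter> Q e = {}"
    and joins_unique: "e \<in> E \<Longrightarrow> e' \<in> E \<Longrightarrow> joins P Q e u v \<Longrightarrow> joins P Q e' u v \<Longrightarrow> e = e'"
begin

text \<open>The sample space under uniform counting. Its product form makes the matchings of
  different slots independent.\<close>

definition outcomes :: "('e \<Rightarrow> nat \<Rightarrow> nat) set" where
  "outcomes = (\<Pi>\<^sub>E e\<in>E. bijections (P e) (Q e))"

definition arcs_of :: "('e \<Rightarrow> nat \<Rightarrow> nat) \<Rightarrow> (nat \<times> nat) set" where
  "arcs_of \<omega> = {(u, v). \<exists>e\<in>E. (u \<in> P e \<and> v = \<omega> e u) \<or> (v \<in> P e \<and> u = \<omega> e v)}"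

text \<open>The probability that \<open>u\<close> and \<open>v\<close> are adjacent: at most one
  slot joins them, and a random bijection sends a given point to a given point with probability
  \<open>1 / card (P e)\<close>.\<close>

definition density :: "nat \<Rightarrow> nat \<Rightarrow> real" where
  "density u v = (\<Sum>e\<in>E. if joins P Q e u v then 1 / real (card (P e)) else 0)"

definition arc_count :: "('e \<Rightarrow> nat \<Rightarrow> nat) \<Rightarrow> nat set \<Rightarrow> nat set \<Rightarrow> real" where
  "arc_count \<omega> A B = (\<Sum>u\<in>A. \<Sum>v\<in>B. of_bool ((u, v) \<in> arcs_of \<omega>))"

definition mean_count :: "nat set \<Rightarrow> nat set \<Rightarrow> real" where
  "mean_count A B = (\<Sum>u\<in>A. \<Sum>v\<in>B. density u v)"

lemma finPQ: "e \<in> E \<Longrightarrow> finite (P e)" "e \<in> E \<Longrightarrow> finite (Q e)"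
  by (meson PV QV finite_subset finite_atLeastLessThan)+

lemma finite_outcomes: "finite outcomes"
  unfolding outcomes_def using finE finPQ by (intro finite_PiE) auto

lemma outcomes_nonempty: "outcomes \<noteq> {}"
  unfolding outcomes_def PiE_eq_empty_iff using bijections_nonempty[OF finPQ card_PQ] by blast

lemma outcomesD:
  assumes "\<omega> \<in> outcomes" "e \<in> E"
  shows "\<omega> e \<in> bijections (P e) (Q e)" "bij_betw (\<omega> e) (P e) (Q e)"
    "u \<in> P e \<Longrightarrow> \<omega> e u \<in> Q e"
  using assms by (auto simp: outcomes_def bijections_def bij_betw_def)

lemma arcs_of_sym: "(u, v) \<in> arcs_of \<omega> \<longleftrightarrow> (v, u) \<in> arcs_of \<omega>"
  by (auto simp: arcs_of_def)

lemma arcs_of_subset: "\<omega> \<in> outcomes \<Longrightarrow> arcs_of \<omega> \<subseteq> {0..<N} \<times> {0..<N}"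
  using outcomesD(3) PV QV unfolding arcs_of_def by blast

lemma arcs_of_irrefl: "\<omega> \<in> outcomes \<Longrightarrow> (u, u) \<notin> arcs_of \<omega>"
  using outcomesD(3) PQ_disjoint unfolding arcs_of_def by fastforce

lemma density_sym: "density u v = density v u"
  unfolding density_def joins_def by (intro sum.cong) auto

lemma density_nonneg: "density u v \<ge> 0"
  unfolding density_def by (intro sum_nonneg) auto

lemma of_bool_arcs:
  assumes "\<omega> \<in> outcomes"
  shows "(of_bool ((u, v) \<in> arcs_of \<omega>) :: real)
    = (\<Sum>e\<in>E. of_bool (u \<in> P e \<and> v = \<omega> e u) + of_bool (v \<in> P e \<and> u = \<omega> e v))"
proof (cases "(u, v) \<in> arcs_of \<omega>")
  case True
  then obtain e where e: "e \<in> E" "(u \<in> P e \<and> v = \<omega> e u) \<or> (v \<in> P e \<and> u = \<omega> e v)"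
    by (auto simp: arcs_of_def)
  have j: "joins P Q e' u v" if "e' \<in> E" "(u \<in> P e' \<and> v = \<omega> e' u) \<or> (v \<in> P e' \<and> u = \<omega> e' v)" for e'
    using that outcomesD(3)[OF assms] by (auto simp: joins_def)
  have other: "(of_bool (u \<in> P e' \<and> v = \<omega> e' u) + of_bool (v \<in> P e' \<and> u = \<omega> e' v) :: real) = 0"
    if "e' \<in> E - {e}" for e'
    using joins_unique[of e e' u v] j[OF e] j[of e'] e that by auto
  have "(of_bool (u \<in> P e \<and> v = \<omega> e u) + of_bool (v \<in> P e \<and> u = \<omega> e v) :: real) = 1"
    using e outcomesD(3)[OF assms e(1)] PQ_disjoint[OF e(1)] by fastforce
  moreover have "(\<Sum>e'\<in>E - {e}. of_bool (u \<in> P e' \<and> v = \<omega> e' u) + of_bool (v \<in> P e' \<and> u = \<omega> e' v) :: real) = 0"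
    using other by (intro sum.neutral) blast
  ultimately show ?thesis using True sum.remove[OF finE e(1),
      of "\<lambda>e. of_bool (u \<in> P e \<and> v = \<omega> e u) + of_bool (v \<in> P e \<and> u = \<omega> e v) :: real"] by simp
next
  case False
  hence "(of_bool (u \<in> P e \<and> v = \<omega> e u) + of_bool (v \<in> P e \<and> u = \<omega> e v) :: real) = 0" if "e \<in> E" for e
    using that by (auto simp: arcs_of_def)
  thus ?thesis using False by simp
qed

text \<open>In each slot a vertex has exactly one partner or none, and \<open>g\<close> takes the
  same value at every possible partner. Hence the identity holds for every outcome and not only on
  average; it yields exact degrees and exact eigenvectors.\<close>

lemma sum_arcs_eq_sum_density:
  assumes \<omega>: "\<omega> \<in> outcomes"
    and P: "\<And>e x y. e \<in> E \<Longrightarrow> x \<in> P e \<Longrightarrow> y \<in> P e \<Longrightarrow> g x = g y"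
    and Q: "\<And>e x y. e \<in> E \<Longrightarrow> x \<in> Q e \<Longrightarrow> y \<in> Q e \<Longrightarrow> g x = g y"
  shows "(\<Sum>v\<in>{0..<N}. of_bool ((u, v) \<in> arcs_of \<omega>) * g v) = (\<Sum>v\<in>{0..<N}. density u v * (g v :: real))"
proof -
  let ?V = "{0..<N}"
  have "(\<Sum>v\<in>?V. of_bool ((u, v) \<in> arcs_of \<omega>) * g v) =
    (\<Sum>e\<in>E. \<Sum>v\<in>?V. (of_bool (u \<in> P e \<and> v = \<omega> e u) + of_bool (v \<in> P e \<and> u = \<omega> e v)) * g v)"
    unfolding of_bool_arcs[OF \<omega>] sum_distrib_right by (rule sum.swap)
  also have "\<dots> = (\<Sum>e\<in>E. \<Sum>v\<in>?V. (if joins P Q e u v then 1 / real (card (P e)) else 0) * g v)"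
  proof (rule sum.cong[OF refl])
    fix e assume e: "e \<in> E"
    note D = outcomesD[OF \<omega> e]
    consider "u \<in> P e" "u \<notin> Q e" | "u \<in> Q e" "u \<notin> P e" | "u \<notin> P e" "u \<notin> Q e"
      using PQ_disjoint[OF e] by blast
    thus "(\<Sum>v\<in>?V. (of_bool (u \<in> P e \<and> v = \<omega> e u) + of_bool (v \<in> P e \<and> u = \<omega> e v)) * g v)
      = (\<Sum>v\<in>?V. (if joins P Q e u v then 1 / real (card (P e)) else 0) * g v)"
    proof cases
      case 1
      have "(\<Sum>v\<in>?V. (of_bool (u \<in> P e \<and> v = \<omega> e u) + of_bool (v \<in> P e \<and> u = \<omega> e v)) * g v)
        = (\<Sum>v\<in>?V. if v = \<omega> e u then g v else 0)"
        using 1 by (intro sum.cong) (auto dest: D(3))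
      also have "\<dots> = g (\<omega> e u)" using D(3)[OF 1(1)] QV[OF e] by auto
      finally have L: "(\<Sum>v\<in>?V. (of_bool (u \<in> P e \<and> v = \<omega> e u) + of_bool (v \<in> P e \<and> u = \<omega> e v)) * g v)
        = g (\<omega> e u)" .
      have "(\<Sum>v\<in>?V. (if joins P Q e u v then 1 / real (card (P e)) else 0) * g v)
        = (\<Sum>v\<in>?V. if v \<in> Q e then 1 / real (card (P e)) * g v else 0)"
        using 1 by (intro sum.cong) (auto simp: joins_def)
      also have "\<dots> = (\<Sum>v\<in>Q e. 1 / real (card (P e)) * g v)"
        using QV[OF e] by (simp add: sum.inter_restrict[symmetric] Int_absorb1)
      also have "\<dots> = (\<Sum>v\<in>Q e. 1 / real (card (P e)) * g (\<omega> e u))"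
        by (intro sum.cong refl arg_cong[where f = "\<lambda>x. _ * x"] Q[OF e _ D(3)[OF 1(1)]])
      also have "\<dots> = g (\<omega> e u)"
        using 1 finPQ[OF e] card_PQ[OF e] by (auto simp: card_gt_0_iff)
      finally show ?thesis using L by simp
    next
      case 2
      hence "u \<in> \<omega> e ` P e" using D(2) by (simp add: bij_betw_def)
      then obtain w where w: "w \<in> P e" "\<omega> e w = u" by blast
      have "(\<Sum>v\<in>?V. (of_bool (u \<in> P e \<and> v = \<omega> e u) + of_bool (v \<in> P e \<and> u = \<omega> e v)) * g v)
        = (\<Sum>v\<in>?V. if v = w then g v else 0)"
        using 2 w D(2) by (intro sum.cong) (auto simp: bij_betw_def inj_on_def)
      also have "\<dots> = g w" using w PV[OF e] by auto
      finally have L: "(\<Sum>v\<in>?V. (of_bool (u \<in> P e \<and> v = \<omega> e u) + of_bool (v \<in> P e \<and> u = \<omega> e v)) * g v)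
        = g w" .
      have "(\<Sum>v\<in>?V. (if joins P Q e u v then 1 / real (card (P e)) else 0) * g v)
        = (\<Sum>v\<in>?V. if v \<in> P e then 1 / real (card (P e)) * g v else 0)"
        using 2 by (intro sum.cong) (auto simp: joins_def)
      also have "\<dots> = (\<Sum>v\<in>P e. 1 / real (card (P e)) * g v)"
        using PV[OF e] by (simp add: sum.inter_restrict[symmetric] Int_absorb1)
      also have "\<dots> = (\<Sum>v\<in>P e. 1 / real (card (P e)) * g w)"
        by (intro sum.cong refl arg_cong[where f = "\<lambda>x. _ * x"] P[OF e _ w(1)])
      also have "\<dots> = g w"
        using w finPQ[OF e] by (auto simp: card_gt_0_iff)
      finally show ?thesis using L by simp
    next
      case 3
      thus ?thesis using D(3) by (intro sum.cong) (auto simp: joins_def)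
    qed
  qed
  also have "\<dots> = (\<Sum>v\<in>?V. density u v * g v)"
    unfolding density_def sum_distrib_right by (rule sum.swap)
  finally show ?thesis .
qed

section \<open>Moment generating function and tails of the arc count between two sets\<close>

definition half_count :: "('e \<Rightarrow> nat \<Rightarrow> nat) \<Rightarrow> nat set \<Rightarrow> nat set \<Rightarrow> nat" where
  "half_count \<omega> A B = (\<Sum>e\<in>E. card {u \<in> A \<inter> P e. \<omega> e u \<in> B \<inter> Q e})"

definition half_mean :: "nat set \<Rightarrow> nat set \<Rightarrow> real" where
  "half_mean A B = (\<Sum>e\<in>E. real (card (A \<inter> P e)) * real (card (B \<inter> Q e)) / real (card (P e)))"

lemma arc_count_eq_half_counts:
  assumes \<omega>: "\<omega> \<in> outcomes" and fin: "finite A" "finite B"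
  shows "arc_count \<omega> A B = real (half_count \<omega> A B) + real (half_count \<omega> B A)"
proof -
  have half: "(\<Sum>u\<in>A. \<Sum>v\<in>B. of_bool (u \<in> P e \<and> v = \<omega> e u)) = real (card {u \<in> A \<inter> P e. \<omega> e u \<in> B \<inter> Q e})"
    if e: "e \<in> E" and fin: "finite A" "finite B" for e A B
  proof -
    have "(\<Sum>v\<in>B. of_bool (u \<in> P e \<and> v = \<omega> e u)) = (of_bool (u \<in> P e \<and> \<omega> e u \<in> B \<inter> Q e) :: real)" for u
    proof -
      have "(\<Sum>v\<in>B. of_bool (u \<in> P e \<and> v = \<omega> e u)) = (\<Sum>v\<in>B. if v = \<omega> e u then of_bool (u \<in> P e) else (0::real))"
        by (intro sum.cong) auto
      thus ?thesis using fin outcomesD(3)[OF \<omega> e] by auto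
    qed
    hence "(\<Sum>u\<in>A. \<Sum>v\<in>B. of_bool (u \<in> P e \<and> v = \<omega> e u)) = (\<Sum>u\<in>A. of_bool (u \<in> P e \<and> \<omega> e u \<in> B \<inter> Q e) :: real)"
      by simp
    also have "\<dots> = real (card {u \<in> A \<inter> P e. \<omega> e u \<in> B \<inter> Q e})"
      using fin by (auto simp: of_bool_def sum.If_cases intro!: arg_cong[where f = card])
    finally show ?thesis .
  qed
  have "arc_count \<omega> A B = (\<Sum>u\<in>A. \<Sum>e\<in>E. \<Sum>v\<in>B. of_bool (u \<in> P e \<and> v = \<omega> e u) + of_bool (v \<in> P e \<and> u = \<omega> e v))"
    unfolding arc_count_def of_bool_arcs[OF \<omega>] by (intro sum.cong refl sum.swap)
  also have "\<dots> = (\<Sum>e\<in>E. \<Sum>u\<in>A. \<Sum>v\<in>B. of_bool (u \<in> P e \<and> v = \<omega> e u) + of_bool (v \<in> P e \<and> u = \<omega> e v))"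
    by (rule sum.swap)
  also have "\<dots> = (\<Sum>e\<in>E. (\<Sum>u\<in>A. \<Sum>v\<in>B. of_bool (u \<in> P e \<and> v = \<omega> e u))
      + (\<Sum>v\<in>B. \<Sum>u\<in>A. of_bool (v \<in> P e \<and> u = \<omega> e v)))"
    by (subst (3) sum.swap) (simp add: sum.distrib)
  also have "\<dots> = (\<Sum>e\<in>E. real (card {u \<in> A \<inter> P e. \<omega> e u \<in> B \<inter> Q e}) + real (card {u \<in> B \<inter> P e. \<omega> e u \<in> A \<inter> Q e}))"
    using half fin by (intro sum.cong) auto
  finally show ?thesis by (simp add: half_count_def sum.distrib)
qed

lemma mean_count_eq_half_means:
  assumes fin: "finite A" "finite B"
  shows "mean_count A B = half_mean A B + half_mean B A"
proof -
  have "mean_count A B = (\<Sum>e\<in>E. \<Sum>u\<in>A. \<Sum>v\<in>B. if joins P Q e u v then 1 / real (card (P e)) else 0)"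
    unfolding mean_count_def density_def by (subst sum.swap[of _ E]) (intro sum.cong refl sum.swap)
  also have "\<dots> = (\<Sum>e\<in>E. real (card (A \<inter> P e)) * real (card (B \<inter> Q e)) / real (card (P e))
      + real (card (B \<inter> P e)) * real (card (A \<inter> Q e)) / real (card (P e)))"
  proof (rule sum.cong[OF refl])
    fix e assume e: "e \<in> E"
    let ?c = "1 / real (card (P e))"
    have ind: "(\<Sum>u\<in>A. of_bool (u \<in> S)) = real (card (A \<inter> S))" if "finite A" for A S :: "nat set"
      using that by (simp add: of_bool_def sum.If_cases)
    have "(\<Sum>u\<in>A. \<Sum>v\<in>B. if joins P Q e u v then ?c else 0)
      = (\<Sum>u\<in>A. \<Sum>v\<in>B. of_bool (u \<in> P e) * of_bool (v \<in> Q e) * ?c + of_bool (u \<in> Q e) * of_bool (v \<in> P e) * ?c)"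
      using PQ_disjoint[OF e] by (intro sum.cong) (auto simp: joins_def)
    also have "\<dots> = (\<Sum>u\<in>A. of_bool (u \<in> P e)) * (\<Sum>v\<in>B. of_bool (v \<in> Q e)) * ?c
      + (\<Sum>u\<in>A. of_bool (u \<in> Q e)) * (\<Sum>v\<in>B. of_bool (v \<in> P e)) * ?c"
      by (simp add: sum_product sum.distrib sum_divide_distrib)
    finally show "(\<Sum>u\<in>A. \<Sum>v\<in>B. if joins P Q e u v then ?c else 0) = real (card (A \<inter> P e)) * real (card (B \<inter> Q e)) / real (card (P e))
      + real (card (B \<inter> P e)) * real (card (A \<inter> Q e)) / real (card (P e))"
      using fin by (simp add: ind)
  qed
  finally show ?thesis by (simp add: half_mean_def sum.distrib)
qed

text \<open>Over a product set, the sum of a product over slots factors into one sum per slot, and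
  the Poisson bounds multiply.\<close>

lemma half_count_mgf:
  fixes z :: real
  assumes "z > 0"
  shows "(\<Sum>\<omega>\<in>outcomes. z ^ half_count \<omega> A B) \<le> real (card outcomes) * exp ((z - 1) * half_mean A B)"
proof -
  have "(\<Sum>\<omega>\<in>outcomes. z ^ half_count \<omega> A B) = (\<Sum>\<omega>\<in>outcomes. \<Prod>e\<in>E. z ^ card {u \<in> A \<inter> P e. \<omega> e u \<in> B \<inter> Q e})"
    by (simp add: half_count_def power_sum)
  also have "\<dots> = (\<Prod>e\<in>E. \<Sum>\<sigma>\<in>bijections (P e) (Q e). z ^ card {u \<in> A \<inter> P e. \<sigma> u \<in> B \<inter> Q e})"
    unfolding outcomes_def using finE finPQ
    by (subst prod_sum_PiE) auto
  also have "\<dots> \<le> (\<Prod>e\<in>E. real (card (bijections (P e) (Q e)))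
      * exp ((z - 1) * (real (card (A \<inter> P e)) * real (card (B \<inter> Q e)) / real (card (P e)))))"
    using assms finPQ card_PQ by (intro prod_mono conjI sum_nonneg hits_mgf) auto
  also have "\<dots> = real (card outcomes) * exp ((z - 1) * half_mean A B)"
    using finE by (simp add: prod.distrib outcomes_def card_PiE half_mean_def exp_sum sum_distrib_left)
  finally show ?thesis .
qed

text \<open>An arc inside \<open>A \<inter> B\<close> is counted by both halves, so the two half counts are not independent;
  the weight \<open>s\<close> makes the arithmetic-geometric mean inequality do the work of Cauchy-Schwarz.\<close>

lemma arc_count_mgf:
  assumes fin: "finite A" "finite B"
  shows "(\<Sum>\<omega>\<in>outcomes. exp (l / 2 * arc_count \<omega> A B))
    \<le> real (card outcomes) * exp ((exp l - 1) / 2 * mean_count A B)"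
proof -
  define z where "z = exp l"
  \<comment> \<open>This value balances the two halves: both terms acquire the same exponent, the
    average of the two original ones.\<close>
  define s where "s = exp ((z - 1) * (half_mean B A - half_mean A B) / 2)"
  have z: "z > 0" and s: "s > 0" by (auto simp: z_def s_def)
  have "(\<Sum>\<omega>\<in>outcomes. exp (l / 2 * arc_count \<omega> A B))
    \<le> (\<Sum>\<omega>\<in>outcomes. (s * z ^ half_count \<omega> A B + z ^ half_count \<omega> B A / s) / 2)"
  proof (rule sum_mono)
    fix \<omega> assume \<omega>: "\<omega> \<in> outcomes"
    define p where "p = exp (l / 2 * real (half_count \<omega> A B))"
    define q where "q = exp (l / 2 * real (half_count \<omega> B A))"
    have pq: "p\<^sup>2 = z ^ half_count \<omega> A B" "q\<^sup>2 = z ^ half_count \<omega> B A"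
      by (simp_all add: p_def q_def z_def exp_of_nat_mult[symmetric] exp_double[symmetric] mult.commute)
    have "0 \<le> (s * p - q)\<^sup>2 / s" using s by simp
    also have "\<dots> = s * p\<^sup>2 + q\<^sup>2 / s - 2 * (p * q)"
      using s by (simp add: power2_eq_square field_simps)
    finally have "p * q \<le> (s * p\<^sup>2 + q\<^sup>2 / s) / 2" by simp
    moreover have "exp (l / 2 * arc_count \<omega> A B) = p * q"
      by (simp add: arc_count_eq_half_counts[OF \<omega> fin] p_def q_def exp_add[symmetric] algebra_simps)
    ultimately show "exp (l / 2 * arc_count \<omega> A B) \<le> (s * z ^ half_count \<omega> A B + z ^ half_count \<omega> B A / s) / 2"
      by (simp add: pq)
  qed
  also have "\<dots> = (s * (\<Sum>\<omega>\<in>outcomes. z ^ half_count \<omega> A B) + (\<Sum>\<omega>\<in>outcomes. z ^ half_count \<omega> B A) / s) / 2"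
    by (simp add: sum.distrib sum_distrib_left sum_divide_distrib add_divide_distrib)
  also have "\<dots> \<le> (s * (real (card outcomes) * exp ((z - 1) * half_mean A B))
      + (real (card outcomes) * exp ((z - 1) * half_mean B A)) / s) / 2"
    using s by (intro divide_right_mono add_mono mult_left_mono half_count_mgf[OF z]) auto
  also have "s * (real (card outcomes) * exp ((z - 1) * half_mean A B))
      = real (card outcomes) * exp ((z - 1) / 2 * mean_count A B)"
    by (simp add: s_def mean_count_eq_half_means[OF fin] exp_add[symmetric] field_simps)
  also have "real (card outcomes) * exp ((z - 1) * half_mean B A) / s
      = real (card outcomes) * exp ((z - 1) / 2 * mean_count A B)"
  proof -
    have "(z - 1) * half_mean B A - (z - 1) * (half_mean B A - half_mean A B) / 2 = (z - 1) / 2 * mean_count A B"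
      by (simp add: mean_count_eq_half_means[OF fin] field_simps)
    thus ?thesis unfolding times_divide_eq_right[symmetric] s_def exp_diff[symmetric] by simp
  qed
  finally show ?thesis by (simp add: z_def)
qed

text \<open>Markov's inequality is applied at \<open>l\<close> for the upper tail and at
  \<open>- l\<close> for the lower one, whose exponent is dominated by the upper one. The halved
  \<open>l\<close> is the price for the two dependent halves.\<close>

lemma arc_count_tail:
  assumes fin: "finite A" "finite B" and l: "l > 0"
  shows "real (card {\<omega> \<in> outcomes. \<bar>arc_count \<omega> A B - mean_count A B\<bar> > T})
    \<le> 2 * real (card outcomes) * exp ((exp l - 1 - l) / 2 * mean_count A B - l / 2 * T)"
proof -
  let ?m = "mean_count A B" and ?X = "\<lambda>\<omega>. arc_count \<omega> A B"
  let ?b = "real (card outcomes) * exp ((exp l - 1 - l) / 2 * ?m - l / 2 * T)"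
  have m: "?m \<ge> 0" unfolding mean_count_def by (intro sum_nonneg density_nonneg)
  have "real (card {\<omega> \<in> outcomes. l / 2 * ?X \<omega> > l / 2 * (?m + T)})
    \<le> real (card outcomes) * exp ((exp l - 1) / 2 * ?m - l / 2 * (?m + T))"
    by (intro markov_exp finite_outcomes arc_count_mgf fin)
  also have "(exp l - 1) / 2 * ?m - l / 2 * (?m + T) = (exp l - 1 - l) / 2 * ?m - l / 2 * T"
    by (simp add: algebra_simps diff_divide_distrib)
  finally have up: "real (card {\<omega> \<in> outcomes. l / 2 * ?X \<omega> > l / 2 * (?m + T)}) \<le> ?b" .
  have "real (card {\<omega> \<in> outcomes. (- l) / 2 * ?X \<omega> > (- l) / 2 * (?m - T)})
    \<le> real (card outcomes) * exp ((exp (- l) - 1) / 2 * ?m - (- l) / 2 * (?m - T))"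
    by (intro markov_exp finite_outcomes arc_count_mgf fin)
  also have "(exp (- l) - 1) / 2 * ?m - (- l) / 2 * (?m - T) = (exp (- l) - 1 + l) / 2 * ?m - l / 2 * T"
    by (simp add: algebra_simps diff_divide_distrib add_divide_distrib)
  also have "real (card outcomes) * exp ((exp (- l) - 1 + l) / 2 * ?m - l / 2 * T) \<le> ?b"
  proof -
    have "(exp (- l) - 1 + l) / 2 * ?m \<le> (exp l - 1 - l) / 2 * ?m"
      using m exp_minus_convex_le[of l] l by (intro mult_right_mono divide_right_mono) auto
    thus ?thesis by (intro mult_left_mono) auto
  qed
  finally have lo: "real (card {\<omega> \<in> outcomes. (- l) / 2 * ?X \<omega> > (- l) / 2 * (?m - T)}) \<le> ?b" .
  have "{\<omega> \<in> outcomes. \<bar>?X \<omega> - ?m\<bar> > T} \<subseteq> {\<omega> \<in> outcomes. l / 2 * ?X \<omega> > l / 2 * (?m + T)}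
      \<union> {\<omega> \<in> outcomes. (- l) / 2 * ?X \<omega> > (- l) / 2 * (?m - T)}"
    using l by (auto simp: abs_if split: if_splits)
  hence "card {\<omega> \<in> outcomes. \<bar>?X \<omega> - ?m\<bar> > T} \<le> card ({\<omega> \<in> outcomes. l / 2 * ?X \<omega> > l / 2 * (?m + T)}
      \<union> {\<omega> \<in> outcomes. (- l) / 2 * ?X \<omega> > (- l) / 2 * (?m - T)})"
    using finite_outcomes by (intro card_mono) auto
  also have "\<dots> \<le> card {\<omega> \<in> outcomes. l / 2 * ?X \<omega> > l / 2 * (?m + T)}
      + card {\<omega> \<in> outcomes. (- l) / 2 * ?X \<omega> > (- l) / 2 * (?m - T)}"
    by (rule card_Un_le)
  finally show ?thesis using up lo by linarith
qed

end

text \<open>Extending \<open>B\<close> to \<open>V\<close> gives full row sums and the bound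
  \<open>R * card A\<close>; symmetry of \<open>f\<close> gives the same with
  \<open>B\<close>.\<close>

lemma sum_rectangle_le_min:
  fixes f :: "'v \<Rightarrow> 'v \<Rightarrow> real"
  assumes fin: "finite V" and AB: "A \<subseteq> V" "B \<subseteq> V"
    and nn: "\<And>u v. u \<in> V \<Longrightarrow> v \<in> V \<Longrightarrow> f u v \<ge> 0"
    and sym: "\<And>u v. u \<in> V \<Longrightarrow> v \<in> V \<Longrightarrow> f u v = f v u"
    and row: "\<And>u. u \<in> V \<Longrightarrow> (\<Sum>v\<in>V. f u v) \<le> R"
  shows "(\<Sum>u\<in>A. \<Sum>v\<in>B. f u v) \<le> R * min (real (card A)) (real (card B))"
proof -
  have *: "(\<Sum>u\<in>A. \<Sum>v\<in>B. f u v) \<le> R * real (card A)" if "A \<subseteq> V" "B \<subseteq> V" for A B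
  proof -
    have "(\<Sum>u\<in>A. \<Sum>v\<in>B. f u v) \<le> (\<Sum>u\<in>A. \<Sum>v\<in>V. f u v)"
      using that fin by (intro sum_mono sum_mono2 nn) auto
    also have "\<dots> \<le> (\<Sum>u\<in>A. R)" using that row by (intro sum_mono) auto
    finally show ?thesis by (simp add: mult.commute)
  qed
  have "(\<Sum>u\<in>A. \<Sum>v\<in>B. f u v) = (\<Sum>v\<in>B. \<Sum>u\<in>A. f v u)"
    using AB sym by (subst sum.swap) (intro sum.cong, auto)
  with *[OF AB] *[OF AB(2,1)] show ?thesis by (auto simp: min_def)
qed

lemma min_le_sqrt_mult:
  fixes a b :: real
  assumes "a \<ge> 0" "b \<ge> 0"
  shows "min a b \<le> sqrt (a * b)"
proof (rule real_le_rsqrt)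
  show "(min a b)\<^sup>2 \<le> a * b"
    using assms unfolding power2_eq_square by (intro mult_mono) auto
qed

section \<open>Union bound over all pairs of vertex sets\<close>

context random_matchings
begin

text \<open>The density bound gives a mean of at most \<open>11/10 * y^2 / N\<close>, and the
  deviation is \<open>6 * y\<close>; halved by the tail bound, these are the constants of
  \<open>chernoff_exponent\<close>. Of the fourth power, two factors pay for the choice of
  \<open>A\<close> and \<open>B\<close>, two remain for the sum over \<open>b\<close>.\<close>

lemma card_large_deviation_le:
  fixes d :: real
  assumes d: "d \<ge> 0" and b: "1 \<le> b" "b \<le> N"
    and dens: "\<And>u v. u < N \<Longrightarrow> v < N \<Longrightarrow> density u v \<le> 11/10 * d / real N"
    and AB: "A \<subseteq> {0..<N}" "B \<subseteq> {0..<N}"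
    and y: "6 * real b \<le> sqrt d * sqrt (real (card A) * real (card B))"
  shows "real (card {\<omega> \<in> outcomes. \<bar>arc_count \<omega> A B - mean_count A B\<bar>
      > 6 * sqrt d * sqrt (real (card A) * real (card B))})
    \<le> 2 * real (card outcomes) / ((exp 1 * real N / real b) ^ b) ^ 4"
proof -
  define y where "y = sqrt d * sqrt (real (card A) * real (card B))"
  define L where "L = real b * (1 + ln (real N / real b))"
  have y2: "y\<^sup>2 = d * (real (card A) * real (card B))" using d by (simp add: y_def power_mult_distrib)
  have L: "L > 0" using b by (simp add: L_def add_pos_nonneg)
  obtain l where l: "l \<ge> 0" "3 * l * y - 11/20 * (y\<^sup>2 / real N) * (exp l - 1 - l) \<ge> 4 * real b * (1 + ln (real N / real b))"
    using chernoff_exponent[of "real b" "real N" y] b y unfolding y_def by auto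
  \<comment> \<open>At \<open>l = 0\<close> the Chernoff exponent vanishes, but it is at least the
    positive number \<open>4 * L\<close>.\<close>
  have "l \<noteq> 0" using l(2) L by (auto simp: L_def)
  with l have l0: "l > 0" by simp
  have fin: "finite A" "finite B" using AB finite_subset by blast+
  have "mean_count A B \<le> (\<Sum>u\<in>A. \<Sum>v\<in>B. 11/10 * d / real N)"
    unfolding mean_count_def using AB by (intro sum_mono dens) auto
  also have "\<dots> = 11/10 * (y\<^sup>2 / real N)" by (simp add: y2)
  finally have "(exp l - 1 - l) / 2 * mean_count A B \<le> (exp l - 1 - l) / 2 * (11/10 * (y\<^sup>2 / real N))"
  proof (rule mult_left_mono)
    show "0 \<le> (exp l - 1 - l) / 2" by (simp add: diff_diff_eq)
  qed
  hence "(exp l - 1 - l) / 2 * mean_count A B - l / 2 * (6 * y) \<le> - (4 * L)"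
  proof -
    have "(exp l - 1 - l) / 2 * (11/10 * (y\<^sup>2 / real N)) = 11/20 * (y\<^sup>2 / real N) * (exp l - 1 - l)" by simp
    moreover have "l / 2 * (6 * y) = 3 * l * y" "4 * real b * (1 + ln (real N / real b)) = 4 * L" by (simp_all add: L_def)
    ultimately show ?thesis using l(2) \<open>(exp l - 1 - l) / 2 * mean_count A B \<le> _\<close> by linarith
  qed
  hence "exp ((exp l - 1 - l) / 2 * mean_count A B - l / 2 * (6 * y)) \<le> exp (- (4 * L))" by simp
  also have "\<dots> = 1 / exp L ^ 4" by (simp add: exp_minus exp_of_nat_mult[symmetric] field_simps)
  also have "exp L = (exp 1 * real N / real b) ^ b"
    using b by (simp add: L_def exp_of_nat_mult exp_add)
  finally have e: "exp ((exp l - 1 - l) / 2 * mean_count A B - l / 2 * (6 * y))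
    \<le> 1 / ((exp 1 * real N / real b) ^ b) ^ 4" .
  have "real (card {\<omega> \<in> outcomes. \<bar>arc_count \<omega> A B - mean_count A B\<bar> > 6 * y})
    \<le> 2 * real (card outcomes) * exp ((exp l - 1 - l) / 2 * mean_count A B - l / 2 * (6 * y))"
    by (rule arc_count_tail[OF fin l0])
  also have "\<dots> \<le> 2 * real (card outcomes) * (1 / ((exp 1 * real N / real b) ^ b) ^ 4)"
    by (intro mult_left_mono e) auto
  finally show ?thesis by (simp add: y_def mult.assoc)
qed

text \<open>Both counts lie between 0 and \<open>d * min ?a ?b\<close>. Since the square of
  \<open>y\<close> is \<open>d * min ?a ?b * max ?a ?b\<close>, the assumption
  \<open>y < 6 * max ?a ?b\<close> bounds this by \<open>6 * y\<close>.\<close>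

lemma deviation_le_of_unbalanced:
  assumes d: "d \<ge> 0" and \<omega>: "\<omega> \<in> outcomes"
    and rows: "\<And>u. u < N \<Longrightarrow> (\<Sum>v\<in>{0..<N}. density u v) = d"
    and AB: "A \<subseteq> {0..<N}" "B \<subseteq> {0..<N}"
    and y: "sqrt d * sqrt (real (card A) * real (card B)) < 6 * max (real (card A)) (real (card B))"
  shows "\<bar>arc_count \<omega> A B - mean_count A B\<bar> \<le> 6 * sqrt d * sqrt (real (card A) * real (card B))"
proof -
  let ?a = "real (card A)" and ?b = "real (card B)"
  define y where "y = sqrt d * sqrt (?a * ?b)"
  have y2: "y\<^sup>2 = d * min ?a ?b * max ?a ?b"
    using d by (auto simp: y_def power_mult_distrib min_def max_def)
  have "arc_count \<omega> A B \<le> d * min ?a ?b"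
    unfolding arc_count_def using AB arcs_of_sym[of _ _ \<omega>] rows sum_arcs_eq_sum_density[OF \<omega>, of "\<lambda>_. 1"]
    by (intro sum_rectangle_le_min[of "{0..<N}"]) auto
  moreover have "mean_count A B \<le> d * min ?a ?b"
    unfolding mean_count_def using AB rows density_sym density_nonneg
    by (intro sum_rectangle_le_min[of "{0..<N}"]) auto
  moreover have "arc_count \<omega> A B \<ge> 0" unfolding arc_count_def by (intro sum_nonneg) auto
  moreover have "mean_count A B \<ge> 0" unfolding mean_count_def by (intro sum_nonneg density_nonneg)
  ultimately have "\<bar>arc_count \<omega> A B - mean_count A B\<bar> \<le> d * min ?a ?b" by linarith
  also have "d * min ?a ?b \<le> 6 * y"
  proof -
    have pos: "max ?a ?b > 0" using y by (cases "card A = 0"; cases "card B = 0") auto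
    have "y \<ge> 0" using d by (simp add: y_def)
    hence "y * y \<le> 6 * max ?a ?b * y" using y unfolding y_def by (intro mult_right_mono) auto
    hence "max ?a ?b * (d * min ?a ?b) \<le> max ?a ?b * (6 * y)"
      using y2 by (simp add: power2_eq_square mult_ac)
    thus ?thesis using pos by simp
  qed
  finally show ?thesis by (simp add: y_def mult.assoc)
qed

theorem ex_outcome_small_deviation:
  fixes d :: real
  assumes d: "d \<ge> 0"
    and rows: "\<And>u. u < N \<Longrightarrow> (\<Sum>v\<in>{0..<N}. density u v) = d"
    and dens: "\<And>u v. u < N \<Longrightarrow> v < N \<Longrightarrow> density u v \<le> 11/10 * d / real N"
  obtains \<omega> where "\<omega> \<in> outcomes"
    "\<And>A B. A \<subseteq> {0..<N} \<Longrightarrow> B \<subseteq> {0..<N} \<Longrightarrow>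
      \<bar>arc_count \<omega> A B - mean_count A B\<bar> \<le> 6 * sqrt d * sqrt (real (card A) * real (card B))"
proof -
  let ?V = "{0..<N}"
  define y where "y A B = sqrt d * sqrt (real (card A) * real (card B))" for A B :: "nat set"
  define bad where "bad A B = {\<omega> \<in> outcomes. \<bar>arc_count \<omega> A B - mean_count A B\<bar> > 6 * sqrt d * sqrt (real (card A) * real (card B))}" for A B
  define X where "X b = {A. A \<subseteq> ?V \<and> card A \<le> b}" for b
  \<comment> \<open>Pairs are grouped by a bound \<open>b\<close> on both sizes, to be taken as the
    larger size; the condition selects the pairs outside the unbalanced regime.\<close>
  define S where "S b = {AB \<in> X b \<times> X b. 6 * real b \<le> y (fst AB) (snd AB)}" for b :: nat
  define q where "q b = (exp 1 * real N / real b) ^ b" for b :: nat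
  have finX: "finite (X b)" for b unfolding X_def by (rule finite_subset[of _ "Pow ?V"]) auto
  have finS: "finite (S b)" for b unfolding S_def using finX by auto
  have bad_fin: "finite (bad A B)" for A B unfolding bad_def using finite_outcomes by auto
  \<comment> \<open>At most \<open>q b ^ 2\<close> pairs, each failing with probability at most
    \<open>2 / q b ^ 4\<close>, leave \<open>2 / q b ^ 2\<close>. Summed over \<open>N\<close>
    values of \<open>b\<close> this stays below 1 because \<open>2 * N < (N + 1)^2\<close>.\<close>
  have b_bound: "real (card (\<Union>AB\<in>S b. bad (fst AB) (snd AB))) \<le> 2 * real (card outcomes) / (real N + 1)\<^sup>2"
    if b: "b \<in> {1..N}" for b
  proof -
    have bN: "1 \<le> b" "b \<le> N" using b by auto
    have q: "q b \<ge> real N + 1" using Suc_le_entropy_power[OF bN] by (simp add: q_def)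
    have cS: "real (card (S b)) \<le> q b ^ 2"
    proof -
      have "card (S b) \<le> card (X b \<times> X b)" unfolding S_def using finX by (intro card_mono) auto
      hence "real (card (S b)) \<le> real (card (X b)) * real (card (X b))"
        by (simp add: card_cartesian_product of_nat_mult[symmetric] del: of_nat_mult)
      also have "\<dots> \<le> q b * q b"
        using card_subsets_card_le[OF bN] by (intro mult_mono) (auto simp: X_def q_def)
      finally show ?thesis by (simp add: power2_eq_square)
    qed
    have "card (\<Union>AB\<in>S b. bad (fst AB) (snd AB)) \<le> (\<Sum>AB\<in>S b. card (bad (fst AB) (snd AB)))"
      by (rule card_UN_le[OF finS])
    hence "real (card (\<Union>AB\<in>S b. bad (fst AB) (snd AB))) \<le> (\<Sum>AB\<in>S b. real (card (bad (fst AB) (snd AB))))"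
      by (simp only: of_nat_sum[symmetric] of_nat_le_iff)
    also have "\<dots> \<le> (\<Sum>AB\<in>S b. 2 * real (card outcomes) / q b ^ 4)"
    proof (rule sum_mono)
      fix AB assume "AB \<in> S b"
      thus "real (card (bad (fst AB) (snd AB))) \<le> 2 * real (card outcomes) / q b ^ 4"
        unfolding bad_def q_def
        by (intro card_large_deviation_le[OF d bN dens]) (auto simp: S_def X_def y_def)
    qed
    also have "\<dots> = real (card (S b)) * (2 * real (card outcomes) / q b ^ 4)" by simp
    also have "\<dots> \<le> q b ^ 2 * (2 * real (card outcomes) / q b ^ 4)"
      using cS q by (intro mult_right_mono) auto
    also have "\<dots> = 2 * real (card outcomes) / q b ^ 2"
      using q by (simp add: power2_eq_square power4_eq_xxxx)
    also have "\<dots> \<le> 2 * real (card outcomes) / (real N + 1)\<^sup>2"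
      using q by (intro divide_left_mono power_mono mult_pos_pos zero_less_power) auto
    finally show ?thesis .
  qed
  have "card (\<Union>b\<in>{1..N}. \<Union>AB\<in>S b. bad (fst AB) (snd AB)) \<le> (\<Sum>b\<in>{1..N}. card (\<Union>AB\<in>S b. bad (fst AB) (snd AB)))"
    by (rule card_UN_le) auto
  hence "real (card (\<Union>b\<in>{1..N}. \<Union>AB\<in>S b. bad (fst AB) (snd AB)))
      \<le> (\<Sum>b\<in>{1..N}. real (card (\<Union>AB\<in>S b. bad (fst AB) (snd AB))))"
    by (simp only: of_nat_sum[symmetric] of_nat_le_iff)
  also have "\<dots> \<le> (\<Sum>b\<in>{1..N}. 2 * real (card outcomes) / (real N + 1)\<^sup>2)"
    by (intro sum_mono b_bound)
  also have "\<dots> = real (card outcomes) * (2 * real N / (real N + 1)\<^sup>2)" by simp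
  also have "\<dots> < real (card outcomes) * 1"
  proof (rule mult_strict_left_mono)
    show "2 * real N / (real N + 1)\<^sup>2 < 1" by (simp add: power2_eq_square algebra_simps add_pos_nonneg)
    show "0 < real (card outcomes)" using finite_outcomes outcomes_nonempty by (simp add: card_gt_0_iff)
  qed
  finally have "card (\<Union>b\<in>{1..N}. \<Union>AB\<in>S b. bad (fst AB) (snd AB)) < card outcomes" by simp
  hence "\<not> outcomes \<subseteq> (\<Union>b\<in>{1..N}. \<Union>AB\<in>S b. bad (fst AB) (snd AB))"
    using card_mono[of "\<Union>b\<in>{1..N}. \<Union>AB\<in>S b. bad (fst AB) (snd AB)" outcomes] finS bad_fin by auto
  then obtain \<omega> where \<omega>: "\<omega> \<in> outcomes" "\<omega> \<notin> (\<Union>b\<in>{1..N}. \<Union>AB\<in>S b. bad (fst AB) (snd AB))" by blast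
  show ?thesis
  proof (rule that[OF \<omega>(1)])
    fix A B assume AB: "A \<subseteq> ?V" "B \<subseteq> ?V"
    define b where "b = max (card A) (card B)"
    have cAB: "card A \<le> N" "card B \<le> N" using card_mono[OF _ AB(1)] card_mono[OF _ AB(2)] by auto
    show "\<bar>arc_count \<omega> A B - mean_count A B\<bar> \<le> 6 * sqrt d * sqrt (real (card A) * real (card B))"
    proof (cases "y A B < 6 * real b")
      case True
      thus ?thesis by (intro deviation_le_of_unbalanced[OF d \<omega>(1) rows AB]) (auto simp: b_def y_def of_nat_max)
    next
      case False
      show ?thesis
      proof (cases "b = 0")
        case True
        hence "A = {}" using AB finite_subset[OF AB(1)] by (simp add: b_def)
        thus ?thesis by (simp add: arc_count_def mean_count_def)
      next
        case b0: False
        have "(A, B) \<in> S b" using False AB by (auto simp: S_def X_def b_def)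
        moreover have "b \<in> {1..N}" using b0 cAB by (auto simp: b_def)
        ultimately have "\<omega> \<notin> bad A B" using \<omega>(2) by fastforce
        thus ?thesis using \<omega>(1) by (simp add: bad_def)
      qed
    qed
  qed
qed

end

section \<open>Fibres with prescribed densities\<close>

text \<open>Fibre \<open>x\<close> is the block of \<open>m\<close> consecutive vertices with
  quotient \<open>x\<close>; its cells are the residue classes modulo \<open>w\<close> of the
  position in the block, equally large when \<open>w\<close> divides \<open>m\<close>.\<close>

definition cell :: "nat \<Rightarrow> nat \<Rightarrow> nat \<Rightarrow> nat \<Rightarrow> nat set" where
  "cell m w x c = {u. u div m = x \<and> u mod m mod w = c}"

lemma card_cell:
  assumes "w dvd m" "m > 0" "c < w"
  shows "card (cell m w x c) = m div w"
proof -
  obtain k where k: "m = w * k" using assms(1) by (rule dvdE)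
  have w: "w > 0" "m div w = k" using assms k by auto
  have lt: "j * w + c < m" if "j < k" for j
  proof -
    have "j * w + c < (j + 1) * w" using assms by simp
    also have "\<dots> \<le> k * w" using that by (intro mult_right_mono) auto
    finally show ?thesis by (simp add: k mult.commute)
  qed
  have "bij_betw (\<lambda>j. x * m + (j * w + c)) {..<k} (cell m w x c)"
  proof (rule bij_betw_byWitness[of _ "\<lambda>u. u mod m div w"])
    show "\<forall>j\<in>{..<k}. (x * m + (j * w + c)) mod m div w = j"
      using lt assms by auto
    show "\<forall>u\<in>cell m w x c. x * m + (u mod m div w * w + c) = u"
      by (auto simp: cell_def)
    show "(\<lambda>j. x * m + (j * w + c)) ` {..<k} \<subseteq> cell m w x c"
      using lt assms by (auto simp: cell_def)
    show "(\<lambda>u. u mod m div w) ` cell m w x c \<subseteq> {..<k}"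
      using assms w by (auto simp: k mult.commute less_mult_imp_div_less)
  qed
  from bij_betw_same_card[OF this] show ?thesis using w by simp
qed

lemma card_fibre: "m > 0 \<Longrightarrow> card {u. u div m = x} = (m::nat)"
  using card_cell[of 1 m 0 x] by (simp add: cell_def)

lemma finite_fibre: "m > 0 \<Longrightarrow> finite {u. u div m = (x::nat)}"
  using card_fibre[of m x] card_ge_0_finite by force

lemma div_less_fibres: "u < f * m \<Longrightarrow> u div m < (f::nat)"
  by (simp add: less_mult_imp_div_less)

lemma fibre_subset: "m > 0 \<Longrightarrow> x < f \<Longrightarrow> {u. u div m = x} \<subseteq> {0..<f * (m::nat)}"
proof
  fix u assume "m > 0" "x < f" "u \<in> {u. u div m = x}"
  hence "u < (x + 1) * m" by (auto simp: dividend_less_div_times add.commute)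
  also have "\<dots> \<le> f * m" using \<open>x < f\<close> by (intro mult_right_mono) auto
  finally show "u \<in> {0..<f * m}" by simp
qed

lemma sum_over_fibres:
  fixes h :: "nat \<Rightarrow> real"
  assumes "m > 0"
  shows "(\<Sum>u\<in>{0..<f * m}. h (u div m)) = real m * (\<Sum>x\<in>{0..<f}. h x)"
proof -
  have "(\<Sum>u\<in>{0..<f * m}. h (u div m)) = (\<Sum>x\<in>{0..<f}. \<Sum>u\<in>{u \<in> {0..<f * m}. u div m = x}. h (u div m))"
    using div_less_fibres by (intro sum.group[symmetric]) auto
  also have "\<dots> = (\<Sum>x\<in>{0..<f}. real m * h x)"
  proof (rule sum.cong[OF refl])
    fix x assume x: "x \<in> {0..<f}"
    hence "{u \<in> {0..<f * m}. u div m = x} = {u. u div m = x}"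
      using fibre_subset[OF assms, of x f] by auto
    thus "(\<Sum>u\<in>{u \<in> {0..<f * m}. u div m = x}. h (u div m)) = real m * h x"
      using card_fibre[OF assms] by simp
  qed
  finally show ?thesis by (simp add: sum_distrib_left)
qed

text \<open>Two distinct fibres \<open>x\<close>, \<open>y\<close> are cut into \<open>W x y\<close> cells each and every pair of cells is matched;
  inside a fibre, \<open>W x x + 1\<close> cells are matched pairwise. Every vertex of \<open>x\<close> then has exactly \<open>W x y\<close>
  neighbours in \<open>y\<close>, and parallel arcs cannot arise.\<close>

locale weighted_fibres =
  fixes f m :: nat and W :: "nat \<Rightarrow> nat \<Rightarrow> nat"
  assumes m_pos: "m > 0"
    and W_sym: "W x y = W y x"
    and W_pos: "x < f \<Longrightarrow> y < f \<Longrightarrow> W x y > 0"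
    and W_dvd: "x < f \<Longrightarrow> y < f \<Longrightarrow> W x y + of_bool (x = y) dvd m"
begin

definition parts :: "nat \<Rightarrow> nat \<Rightarrow> nat" where
  "parts x y = W x y + of_bool (x = y)"

text \<open>The order conditions list every unordered pair of cells to be matched once, and keep a
  cell from being matched with itself.\<close>

definition pairs :: "(nat \<times> nat \<times> nat \<times> nat) set" where
  "pairs = {(x, y, c, c'). x \<le> y \<and> y < f \<and> c < parts x y \<and> c' < parts x y \<and> (x = y \<longrightarrow> c < c')}"

definition left :: "nat \<times> nat \<times> nat \<times> nat \<Rightarrow> nat set" where
  "left = (\<lambda>(x, y, c, c'). cell m (parts x y) x c)"

definition right :: "nat \<times> nat \<times> nat \<times> nat \<Rightarrow> nat set" where
  "right = (\<lambda>(x, y, c, c'). cell m (parts x y) y c')"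

lemma parts_sym: "parts x y = parts y x"
  by (auto simp: parts_def W_sym)

lemma parts_pos: "x < f \<Longrightarrow> y < f \<Longrightarrow> parts x y > 0"
  using W_pos by (simp add: parts_def)

lemma parts_dvd: "x < f \<Longrightarrow> y < f \<Longrightarrow> parts x y dvd m"
  using W_dvd by (simp add: parts_def)

sublocale random_matchings "f * m" pairs left right
proof
  show "finite pairs"
  proof (rule finite_subset)
    define M where "M = Max ((\<lambda>(x, y). parts x y) ` ({..<f} \<times> {..<f}))"
    have "parts x y \<le> M" if "x < f" "y < f" for x y
      unfolding M_def using that by (intro Max_ge) auto
    hence "x < f \<and> y < f \<and> c < M \<and> c' < M"
      if "x \<le> y" "y < f" "c < parts x y" "c' < parts x y" for x y c c'
      using that by (meson le_less_trans less_le_trans)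
    thus "pairs \<subseteq> {..<f} \<times> {..<f} \<times> {..<M} \<times> {..<M}"
      unfolding pairs_def by blast
  qed auto
  fix e assume e: "e \<in> pairs"
  obtain x y c c' where [simp]: "e = (x, y, c, c')" by (cases e)
  have xy: "x < f" "y < f" "x \<le> y" "c < parts x y" "c' < parts x y" "x = y \<longrightarrow> c < c'" using e by (auto simp: pairs_def)
  show "left e \<subseteq> {0..<f * m}" "right e \<subseteq> {0..<f * m}"
    using fibre_subset[OF m_pos xy(1)] fibre_subset[OF m_pos xy(2)] by (auto simp: left_def right_def cell_def)
  show "card (left e) = card (right e)"
    using xy card_cell[OF parts_dvd m_pos] by (simp add: left_def right_def)
  show "left e \<inter> right e = {}"
    using xy by (auto simp: left_def right_def cell_def)
  \<comment> \<open>The quotients and residues of \<open>u\<close> and \<open>v\<close> determine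
    \<open>(x, y, c, c')\<close>, the order conditions fixing which endpoint comes first.\<close>
  fix e' u v assume e': "e' \<in> pairs" "joins left right e u v" "joins left right e' u v"
  thus "e = e'" using xy
    by (cases e') (auto simp: pairs_def joins_def left_def right_def cell_def parts_sym)
qed

definition cell_index :: "nat \<Rightarrow> nat" where
  "cell_index u = u mod m mod parts (u div m) (u div m)"

lemma density_eq_of_joins:
  assumes "x < f" "y < f" "e \<in> pairs" "joins left right e u v" "e = (x, y, c, c')"
  shows "density u v = real (parts x y) / real m"
proof -
  have "density u v = (\<Sum>e'\<in>{e}. if joins left right e' u v then 1 / real (card (left e')) else 0)"
    unfolding density_def
  proof (rule sum.mono_neutral_right[OF finE])
    show "\<forall>e'\<in>pairs - {e}. (if joins left right e' u v then 1 / real (card (left e')) else 0) = 0"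
      using joins_unique[OF assms(3) _ assms(4)] by (metis DiffE insertI1)
  qed (use assms(3) in simp)
  also have "\<dots> = 1 / real (m div parts x y)"
  proof -
    have "c < parts x y" using assms(3,5) by (simp add: pairs_def)
    thus ?thesis using card_cell[OF parts_dvd[OF assms(1,2)] m_pos] assms(4,5) by (simp add: left_def)
  qed
  also have "\<dots> = real (parts x y) / real m"
    using parts_dvd[OF assms(1,2)] by (simp add: real_of_nat_div)
  finally show ?thesis .
qed

text \<open>The basic density is \<open>W / m\<close>. Within a fibre the extra cell adds
  \<open>1 / m\<close>, and pairs in a common cell are never adjacent, so there everything is
  subtracted. Each of the two corrections has row sum 1.\<close>

lemma density_eq:
  assumes u: "u < f * m" and v: "v < f * m"
  shows "density u v = real (W (u div m) (v div m)) / real m + of_bool (u div m = v div m) / real m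
    - of_bool (u div m = v div m \<and> cell_index u = cell_index v) * real (parts (u div m) (u div m)) / real m"
proof -
  let ?x = "u div m" and ?y = "v div m"
  let ?c = "u mod m mod parts ?x ?y" and ?c' = "v mod m mod parts ?x ?y"
  have xy: "?x < f" "?y < f" using u v by (auto intro: div_less_fibres)
  have c: "?c < parts ?x ?y" "?c' < parts ?x ?y" using parts_pos[OF xy] by auto
  consider "?x < ?y" | "?y < ?x" | "?x = ?y" "?c < ?c'" | "?x = ?y" "?c' < ?c" | "?x = ?y" "?c = ?c'" by linarith
  thus ?thesis
  proof cases
    case 1
    have "density u v = real (parts ?x ?y) / real m"
      using 1 xy c by (intro density_eq_of_joins[where e = "(?x, ?y, ?c, ?c')"])
        (auto simp: pairs_def joins_def left_def right_def cell_def)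
    thus ?thesis using 1 by (simp add: parts_def)
  next
    case 2
    have "density u v = real (parts ?y ?x) / real m"
      using 2 xy c by (intro density_eq_of_joins[where e = "(?y, ?x, ?c', ?c)"])
        (auto simp: pairs_def joins_def left_def right_def cell_def parts_sym)
    thus ?thesis using 2 by (simp add: parts_def W_sym)
  next
    case 3
    have "density u v = real (parts ?x ?y) / real m"
      using 3 xy c by (intro density_eq_of_joins[where e = "(?x, ?y, ?c, ?c')"])
        (auto simp: pairs_def joins_def left_def right_def cell_def)
    thus ?thesis using 3 by (auto simp: parts_def cell_index_def add_divide_distrib)
  next
    case 4
    have "density u v = real (parts ?y ?x) / real m"
      using 4 xy c by (intro density_eq_of_joins[where e = "(?y, ?x, ?c', ?c)"])
        (auto simp: pairs_def joins_def left_def right_def cell_def parts_sym)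
    thus ?thesis using 4 by (auto simp: parts_def cell_index_def add_divide_distrib)
  next
    case 5
    have "\<not> joins left right e u v" if "e \<in> pairs" for e
      using 5 that by (cases e) (auto simp: pairs_def joins_def left_def right_def cell_def)
    hence "density u v = 0" by (simp add: density_def)
    thus ?thesis using 5 by (simp add: parts_def cell_index_def add_divide_distrib)
  qed
qed

lemma sum_same_class:
  assumes "u < f * m"
  shows "(\<Sum>v\<in>{0..<f * m}. of_bool (u div m = v div m \<and> cell_index u = cell_index v)
    * real (parts (u div m) (u div m)) / real m) = 1"
proof -
  let ?x = "u div m"
  let ?w = "parts ?x ?x"
  have x: "?x < f" using assms by (rule div_less_fibres)
  have eq: "{v \<in> {0..<f * m}. u div m = v div m \<and> cell_index u = cell_index v} = cell m ?w ?x (cell_index u)"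
    using fibre_subset[OF m_pos x] by (auto simp: cell_def cell_index_def)
  have "card (cell m ?w ?x (cell_index u)) = m div ?w"
    using parts_pos[OF x x] by (intro card_cell parts_dvd x m_pos) (simp add: cell_index_def)
  hence "(\<Sum>v\<in>{0..<f * m}. of_bool (u div m = v div m \<and> cell_index u = cell_index v) :: real) = real (m div ?w)"
    using eq by (simp add: of_bool_def sum.If_cases Int_def)
  also have "\<dots> = real m / real ?w" using parts_dvd[OF x x] by (simp add: real_of_nat_div)
  finally have "(\<Sum>v\<in>{0..<f * m}. of_bool (u div m = v div m \<and> cell_index u = cell_index v) :: real) = real m / real ?w" .
  thus ?thesis using m_pos parts_pos[OF x x] by (simp add: sum_distrib_right[symmetric] sum_divide_distrib[symmetric])
qed

lemma sum_same_fibre: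
  assumes "u < f * m"
  shows "(\<Sum>v\<in>{0..<f * m}. of_bool (u div m = v div m) / real m) = 1"
proof -
  have "(\<Sum>v\<in>{0..<f * m}. of_bool (u div m = v div m) / real m)
    = real m * (\<Sum>y\<in>{0..<f}. of_bool (u div m = y) / real m)"
    by (rule sum_over_fibres[OF m_pos])
  also have "(\<Sum>y\<in>{0..<f}. of_bool (u div m = y) / real m) = (\<Sum>y\<in>{0..<f}. if y = u div m then 1 / real m else 0)"
    by (intro sum.cong) auto
  finally show ?thesis using div_less_fibres[OF assms] m_pos by simp
qed

text \<open>Both corrections live on the fibre of \<open>u\<close>, where \<open>g\<close> is
  constant, and have equal row sums, so they cancel.\<close>

lemma sum_density_fibre_function:
  assumes u: "u < f * m"
  shows "(\<Sum>v\<in>{0..<f * m}. density u v * g (v div m)) = (\<Sum>y\<in>{0..<f}. real (W (u div m) y) * g y)"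
proof -
  let ?V = "{0..<f * m}" and ?x = "u div m"
  let ?D = "\<lambda>v. of_bool (?x = v div m) / real m"
  let ?C = "\<lambda>v. of_bool (?x = v div m \<and> cell_index u = cell_index v) * real (parts ?x ?x) / real m"
  have "(\<Sum>v\<in>?V. density u v * g (v div m))
    = (\<Sum>v\<in>?V. real (W ?x (v div m)) / real m * g (v div m) + ?D v * g ?x - ?C v * g ?x)"
    using u by (intro sum.cong refl) (auto simp: density_eq algebra_simps)
  also have "\<dots> = (\<Sum>v\<in>?V. real (W ?x (v div m)) / real m * g (v div m)) + (\<Sum>v\<in>?V. ?D v) * g ?x - (\<Sum>v\<in>?V. ?C v) * g ?x"
    by (simp only: sum.distrib sum_subtractf sum_distrib_right)
  also have "\<dots> = (\<Sum>v\<in>?V. real (W ?x (v div m)) / real m * g (v div m))"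
    by (simp only: sum_same_class[OF u] sum_same_fibre[OF u])
  also have "\<dots> = real m * (\<Sum>y\<in>{0..<f}. real (W ?x y) / real m * g y)"
    by (rule sum_over_fibres[OF m_pos])
  also have "\<dots> = (\<Sum>y\<in>{0..<f}. real (W ?x y) * g y)"
    using m_pos by (simp add: sum_distrib_left)
  finally show ?thesis .
qed

text \<open>For every outcome the fibres form an equitable partition with quotient matrix
  \<open>W\<close>; row sums and eigenvectors of \<open>W\<close> therefore lift to the
  graph.\<close>

lemma sum_arcs_fibre_function:
  assumes "\<omega> \<in> outcomes" "u < f * m"
  shows "(\<Sum>v\<in>{0..<f * m}. of_bool ((u, v) \<in> arcs_of \<omega>) * g (v div m)) = (\<Sum>y\<in>{0..<f}. real (W (u div m) y) * g y)"
  using sum_arcs_eq_sum_density[OF assms(1), of "\<lambda>v. g (v div m)" u] sum_density_fibre_function[OF assms(2), of g]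
  by (force simp: left_def right_def cell_def)

lemma same_fibre_bounds:
  assumes AB: "A \<subseteq> {0..<f * m}" "B \<subseteq> {0..<f * m}"
  shows "0 \<le> (\<Sum>u\<in>A. \<Sum>v\<in>B. of_bool (u div m = v div m) / real m)"
    "(\<Sum>u\<in>A. \<Sum>v\<in>B. of_bool (u div m = v div m) / real m) \<le> sqrt (real (card A) * real (card B))"
proof -
  have "(\<Sum>u\<in>A. \<Sum>v\<in>B. of_bool (u div m = v div m) / real m) \<le> 1 * min (real (card A)) (real (card B))"
    using sum_same_fibre by (intro sum_rectangle_le_min[OF _ AB]) auto
  thus "(\<Sum>u\<in>A. \<Sum>v\<in>B. of_bool (u div m = v div m) / real m) \<le> sqrt (real (card A) * real (card B))"
    using min_le_sqrt_mult[of "real (card A)" "real (card B)"] by linarith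
qed (intro sum_nonneg, simp)

text \<open>The two fibre corrections have opposite signs and each is at most the square root.
  Keeping the positive one inside \<open>M\<close> lets both together cost one square root instead
  of two.\<close>

lemma mean_count_bounds:
  assumes AB: "A \<subseteq> {0..<f * m}" "B \<subseteq> {0..<f * m}"
  defines "M \<equiv> (\<Sum>u\<in>A. \<Sum>v\<in>B. real (W (u div m) (v div m)) / real m)
    + (\<Sum>u\<in>A. \<Sum>v\<in>B. of_bool (u div m = v div m) / real m)"
  shows "mean_count A B \<le> M" "M - sqrt (real (card A) * real (card B)) \<le> mean_count A B"
proof -
  let ?C = "\<lambda>u v. of_bool (u div m = v div m \<and> cell_index u = cell_index v) * real (parts (u div m) (u div m)) / real m"
  have "mean_count A B = (\<Sum>u\<in>A. \<Sum>v\<in>B. real (W (u div m) (v div m)) / real m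
      + of_bool (u div m = v div m) / real m - ?C u v)"
    unfolding mean_count_def using AB by (intro sum.cong refl density_eq) auto
  hence eq: "mean_count A B = M - (\<Sum>u\<in>A. \<Sum>v\<in>B. ?C u v)"
    by (simp only: M_def sum.distrib sum_subtractf)
  have "(\<Sum>u\<in>A. \<Sum>v\<in>B. ?C u v) \<le> 1 * min (real (card A)) (real (card B))"
    using sum_same_class by (intro sum_rectangle_le_min[OF _ AB]) auto
  moreover have "(\<Sum>u\<in>A. \<Sum>v\<in>B. ?C u v) \<ge> 0" by (intro sum_nonneg) simp
  ultimately show "mean_count A B \<le> M" "M - sqrt (real (card A) * real (card B)) \<le> mean_count A B"
    using min_le_sqrt_mult[of "real (card A)" "real (card B)"] eq by linarith+
qed

end

section \<open>Levels\<close>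

lemma sum_half_powers_le:
  fixes \<tau> :: real
  assumes "\<tau> > 0"
  shows "(\<Sum>i\<in>{i \<in> {..s}. 2 ^ i > \<tau>}. (1/2) ^ i) \<le> 2 / \<tau>"
proof (cases "{i \<in> {..s}. 2 ^ i > \<tau>} = {}")
  case True
  show ?thesis unfolding True using assms by simp
next
  case False
  define k where "k = Min {i \<in> {..s}. 2 ^ i > \<tau>}"
  have k: "k \<le> s" "2 ^ k > \<tau>" using Min_in[of "{i \<in> {..s}. 2 ^ i > \<tau>}"] False by (auto simp: k_def)
  have geo: "(\<Sum>i\<in>{k..<k + n}. (1/2) ^ i) = 2 * (1/2) ^ k - 2 * (1/2 :: real) ^ (k + n)" for n
    by (induction n) (simp_all add: atLeastLessThanSuc)
  have "(\<Sum>i\<in>{i \<in> {..s}. 2 ^ i > \<tau>}. (1/2) ^ i) \<le> (\<Sum>i\<in>{k..<k + (Suc s - k)}. (1/2 :: real) ^ i)"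
    using k by (intro sum_mono2) (auto simp: k_def)
  also have "\<dots> \<le> 2 * (1/2) ^ k" unfolding geo by simp
  also have "\<dots> = 2 / 2 ^ k" by (simp add: power_one_over)
  also have "\<dots> \<le> 2 / \<tau>" using k assms by (intro divide_left_mono) auto
  finally show ?thesis .
qed

text \<open>The weight \<open>2 ^ l u\<close> is of order \<open>2 ^ s * sqrt (m / rank u)\<close>, whence the square root.\<close>

lemma sum_pow2_level_le:
  fixes l :: "'a \<Rightarrow> nat" and m :: real
  assumes fin: "finite C" and m: "m > 0"
    and lev: "\<And>u. u \<in> C \<Longrightarrow> l u \<le> s"
    and cnt: "\<And>i. i \<le> s \<Longrightarrow> real (card {u \<in> C. l u = i}) \<le> 2 * 4 ^ (s - i) * m"
  shows "(\<Sum>u\<in>C. 2 ^ l u) \<le> 4 * 2 ^ s * sqrt (m * real (card C))"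
proof (cases "C = {}")
  case False
  define c where "c = real (card C)"
  have c: "c > 0" using False fin by (simp add: c_def card_gt_0_iff)
  \<comment> \<open>Weights up to \<open>\<tau>\<close> contribute at most
    \<open>c * \<tau>\<close>, larger ones at most \<open>4 * 4 ^ s * m / \<tau>\<close> by the
    geometric tail. This threshold makes the two bounds equal.\<close>
  define \<tau> where "\<tau> = 2 * 2 ^ s * sqrt (m / c)"
  have \<tau>: "\<tau> > 0" using m c by (simp add: \<tau>_def)
  have "(\<Sum>u\<in>C. 2 ^ l u) \<le> (\<Sum>u\<in>C. \<tau> + (if 2 ^ l u > \<tau> then 2 ^ l u else 0))"
    using \<tau> by (intro sum_mono) auto
  also have "\<dots> = c * \<tau> + (\<Sum>u\<in>C. if 2 ^ l u > \<tau> then 2 ^ l u else 0)"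
    by (simp add: sum.distrib c_def)
  also have "(\<Sum>u\<in>C. if 2 ^ l u > \<tau> then 2 ^ l u else 0)
      = (\<Sum>i\<in>{..s}. \<Sum>u\<in>{u \<in> C. l u = i}. if 2 ^ l u > \<tau> then 2 ^ l u else 0)"
    using fin lev by (intro sum.group[symmetric]) auto
  also have "\<dots> = (\<Sum>i\<in>{..s}. if 2 ^ i > \<tau> then real (card {u \<in> C. l u = i}) * 2 ^ i else 0)"
    by (intro sum.cong) auto
  also have "\<dots> = (\<Sum>i\<in>{i \<in> {..s}. 2 ^ i > \<tau>}. real (card {u \<in> C. l u = i}) * 2 ^ i)"
    by (rule sum.inter_filter[symmetric]) simp
  also have "\<dots> \<le> (\<Sum>i\<in>{i \<in> {..s}. 2 ^ i > \<tau>}. 2 * 4 ^ s * m * (1/2) ^ i)"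
  proof (rule sum_mono)
    fix i assume i: "i \<in> {i \<in> {..s}. 2 ^ i > \<tau>}"
    have "(4::real) ^ i = 2 ^ i * 2 ^ i" by (simp add: power_mult_distrib[symmetric])
    hence p: "4 ^ (s - i) * 2 ^ i = 4 ^ s * (1/2 :: real) ^ i"
      using i by (simp add: power_diff power_one_over field_simps)
    have "real (card {u \<in> C. l u = i}) * 2 ^ i \<le> 2 * 4 ^ (s - i) * m * 2 ^ i"
      using cnt i by (intro mult_right_mono) auto
    also have "\<dots> = 2 * m * (4 ^ (s - i) * 2 ^ i)" by simp
    finally show "real (card {u \<in> C. l u = i}) * 2 ^ i \<le> 2 * 4 ^ s * m * (1/2) ^ i"
      unfolding p by (simp add: mult_ac)
  qed
  also have "\<dots> = 2 * 4 ^ s * m * (\<Sum>i\<in>{i \<in> {..s}. 2 ^ i > \<tau>}. (1/2) ^ i)" by (simp only: sum_distrib_left)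
  also have "\<dots> \<le> 2 * 4 ^ s * m * (2 / \<tau>)"
    using m by (intro mult_left_mono sum_half_powers_le \<tau>) auto
  also have "c * \<tau> = 2 * 2 ^ s * sqrt (m * c)"
  proof -
    have "c * sqrt (m / c) = sqrt (m * c)" using c m by (simp add: real_sqrt_divide real_sqrt_mult field_simps)
    thus ?thesis by (simp add: \<tau>_def mult_ac)
  qed
  also have "2 * 4 ^ s * m * (2 / \<tau>) = 2 * 2 ^ s * sqrt (m * c)"
  proof -
    have "(4::real) ^ s = 2 ^ s * 2 ^ s" by (simp add: power_mult_distrib[symmetric])
    moreover have "m / sqrt (m / c) = sqrt (m * c)"
      using c m by (simp add: real_sqrt_divide real_sqrt_mult field_simps)
    moreover have "2 * (2 ^ s * 2 ^ s) * m * (2 / (2 * 2 ^ s * sqrt (m / c))) = 2 * 2 ^ s * (m / sqrt (m / c))"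
      by simp
    ultimately show ?thesis by (simp only: \<tau>_def)
  qed
  finally show ?thesis by (simp add: c_def)
qed simp

lemma sum_pow4: "3 * (\<Sum>i\<le>s. 4 ^ (s - i)) + 1 = (4::nat) ^ (s + 1)"
proof -
  have "(\<Sum>i\<le>s. (4::nat) ^ (s - i)) = (\<Sum>i\<le>s. 4 ^ i)"
    by (rule sum.reindex_bij_witness[of _ "\<lambda>i. s - i" "\<lambda>i. s - i"]) auto
  moreover have "3 * (\<Sum>i\<le>s. 4 ^ i) + 1 = (4::nat) ^ (s + 1)" by (induction s) simp_all
  ultimately show ?thesis by simp
qed

definition fibre_count :: "nat \<Rightarrow> nat" where
  "fibre_count s = 2 * (\<Sum>i\<le>s. 4 ^ (s - i))"

lemma fibre_count_bounds: "2 * 4 ^ s \<le> fibre_count s" "3 * fibre_count s \<le> 8 * 4 ^ s"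
  using sum_pow4[of s] one_le_power[of "4::nat" s] unfolding fibre_count_def by auto

text \<open>The fibres are numbered by an arbitrary bijection onto triples of sign, level and index.
  Opposite signs cancel in the signed sum, while each level adds \<open>2 * 4 ^ s\<close> to the sum
  of squares.\<close>

lemma ex_signed_levels:
  obtains lev :: "nat \<Rightarrow> nat" and sg :: "nat \<Rightarrow> int" where
    "\<And>x. x < fibre_count s \<Longrightarrow> lev x \<le> s"
    "\<And>x. sg x = 1 \<or> sg x = - 1"
    "\<And>i. i \<le> s \<Longrightarrow> card {x \<in> {0..<fibre_count s}. lev x = i} = 2 * 4 ^ (s - i)"
    "(\<Sum>x\<in>{0..<fibre_count s}. sg x * 2 ^ lev x) = 0"
    "(\<Sum>x\<in>{0..<fibre_count s}. 4 ^ lev x :: nat) = 2 * (s + 1) * 4 ^ s"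
proof -
  define X where "X = (SIGMA i:{..s}. {0..<4 ^ (s - i) :: nat})"
  define F where "F = (UNIV :: bool set) \<times> X"
  have sumX: "(\<Sum>p\<in>X. h (fst p)) = (\<Sum>i\<le>s. of_nat (4 ^ (s - i)) * h i)" for h :: "nat \<Rightarrow> 'b :: comm_semiring_1"
    unfolding X_def by (subst sum.Sigma[symmetric, where g = "\<lambda>i j. h i", unfolded split_def]) auto
  have finX: "finite X" by (simp add: X_def)
  have cardX: "card X = (\<Sum>i\<le>s. 4 ^ (s - i))" by (simp add: X_def)
  have "finite F" "card F = fibre_count s" using finX by (simp_all add: F_def fibre_count_def cardX card_cartesian_product)
  then obtain h where h: "bij_betw h {0..<fibre_count s} F"
    using ex_bij_betw_nat_finite[of F] by metis
  \<comment> \<open>The cap at \<open>s\<close> acts only outside the range, where \<open>h\<close>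
    is arbitrary.\<close>
  define lev where "lev x = min s (fst (snd (h x)))" for x
  define sg where "sg x = (if fst (h x) then 1 else - 1 :: int)" for x
  have mem: "h x \<in> F" if "x < fibre_count s" for x using h that by (auto simp: bij_betw_def)
  have lev: "lev x = fst (snd (h x))" if "x < fibre_count s" for x
    using mem[OF that] by (auto simp: lev_def F_def X_def)
  show ?thesis
  proof (rule that[of lev sg])
    show "lev x \<le> s" for x by (simp add: lev_def)
    show "sg x = 1 \<or> sg x = - 1" for x by (simp add: sg_def)
    fix i assume i: "i \<le> s"
    have "bij_betw h {x \<in> {0..<fibre_count s}. lev x = i} (UNIV \<times> ({i} \<times> {0..<4 ^ (s - i)}))"
    proof (rule bij_betw_subset[OF h])
      have "h ` {x \<in> {0..<fibre_count s}. lev x = i} = {p \<in> F. fst (snd p) = i}"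
      proof -
        have "{x \<in> {0..<fibre_count s}. lev x = i} = {x \<in> {0..<fibre_count s}. fst (snd (h x)) = i}"
          using lev by auto
        also have "h ` \<dots> = {p \<in> h ` {0..<fibre_count s}. fst (snd p) = i}" by blast
        finally show ?thesis using h by (simp add: bij_betw_def)
      qed
      thus "h ` {x \<in> {0..<fibre_count s}. lev x = i} = UNIV \<times> ({i} \<times> {0..<4 ^ (s - i)})"
        using i by (auto simp: F_def X_def)
    qed auto
    from bij_betw_same_card[OF this] show "card {x \<in> {0..<fibre_count s}. lev x = i} = 2 * 4 ^ (s - i)"
      by (simp add: card_cartesian_product)
  next
    have "(\<Sum>x\<in>{0..<fibre_count s}. sg x * 2 ^ lev x) = (\<Sum>x\<in>{0..<fibre_count s}. (\<lambda>p. (if fst p then 1 else - 1) * 2 ^ fst (snd p)) (h x))"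
      using lev by (intro sum.cong) (auto simp: sg_def)
    also have "\<dots> = (\<Sum>p\<in>F. (if fst p then 1 else - 1) * 2 ^ fst (snd p))"
      by (rule sum.reindex_bij_betw[OF h])
    also have "\<dots> = 0" unfolding F_def sum.cartesian_product' by (simp add: UNIV_bool sum_negf)
    finally show "(\<Sum>x\<in>{0..<fibre_count s}. sg x * 2 ^ lev x) = 0" .
  next
    have "(\<Sum>x\<in>{0..<fibre_count s}. 4 ^ lev x :: nat) = (\<Sum>x\<in>{0..<fibre_count s}. (\<lambda>p. 4 ^ fst (snd p)) (h x))"
      using lev by (intro sum.cong) auto
    also have "\<dots> = (\<Sum>p\<in>F. 4 ^ fst (snd p))"
      by (rule sum.reindex_bij_betw[OF h])
    also have "\<dots> = 2 * (\<Sum>p\<in>X. 4 ^ fst p)" unfolding F_def sum.cartesian_product' by (simp add: UNIV_bool)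
    also have "(\<Sum>p\<in>X. (4::nat) ^ fst p) = (\<Sum>i\<le>s. 4 ^ s)"
      unfolding sumX[of "\<lambda>i. 4 ^ i"] by (intro sum.cong) (auto simp: power_add[symmetric])
    finally show "(\<Sum>x\<in>{0..<fibre_count s}. 4 ^ lev x :: nat) = 2 * (s + 1) * 4 ^ s" by simp
  qed
qed

section \<open>Spectrum and degrees\<close>

text \<open>Distinct values occupy distinct positions, so one of them sits at position 1 or
  later.\<close>

lemma second_of_sorted_desc:
  fixes xs :: "real list"
  assumes "sorted xs" "a \<in> set xs" "b \<in> set xs" "a \<noteq> b"
  shows "min a b \<le> rev xs ! 1"
proof -
  let ?r = "rev xs"
  obtain i j where ij: "i < length ?r" "?r ! i = a" "j < length ?r" "?r ! j = b"
    using assms(2,3) by (metis in_set_conv_nth set_rev)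
  have anti: "?r ! k \<le> ?r ! 1" if "1 \<le> k" "k < length ?r" for k
    using that assms(1) by (simp add: rev_nth sorted_nth_mono)
  show ?thesis
  proof (cases "i = 0")
    case True
    hence "j \<noteq> 0" using ij assms(4) by metis
    thus ?thesis using anti[of j] ij by auto
  next
    case False
    thus ?thesis using anti[of i] ij by auto
  qed
qed

lemma mem_eigenvalues_desc:
  fixes M :: "real mat"
  assumes M: "M \<in> carrier_mat n n" and v: "v \<in> carrier_vec n" "v \<noteq> 0\<^sub>v n"
    and ev: "M *\<^sub>v v = \<mu> \<cdot>\<^sub>v v"
  shows "\<mu> \<in> set (sorted_list_of_multiset (proots (char_poly M)))"
proof -
  have "eigenvalue M \<mu>" unfolding eigenvalue_def eigenvector_def using assms by auto
  hence "poly (char_poly M) \<mu> = 0" using eigenvalue_root_char_poly[OF M] by simp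
  moreover have "char_poly M \<noteq> 0" using degree_monic_char_poly[OF M] by auto
  ultimately show ?thesis by simp
qed

text \<open>Two different eigenvalues, each witnessed by an eigenvector, are different roots of the
  characteristic polynomial; the smaller is thus at most the second entry of the list.\<close>

lemma second_eigenvalue_ge:
  assumes ev1: "\<And>u. u < n \<Longrightarrow> (\<Sum>v\<in>{0..<n}. of_bool ((u, v) \<in> parcs G) * g1 v) = \<mu>1 * g1 u"
    and ev2: "\<And>u. u < n \<Longrightarrow> (\<Sum>v\<in>{0..<n}. of_bool ((u, v) \<in> parcs G) * g2 v) = \<mu>2 * g2 u"
    and nz1: "u1 < n" "g1 u1 \<noteq> 0" and nz2: "u2 < n" "g2 u2 \<noteq> 0"
    and less: "\<mu>2 < \<mu>1"
  shows "\<mu>2 \<le> second_eigenvalue n G"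
proof -
  let ?M = "adjacency_matrix n G"
  have M: "?M \<in> carrier_mat n n" by (simp add: adjacency_matrix_def)
  have mem: "\<mu> \<in> set (sorted_list_of_multiset (proots (char_poly ?M)))"
    if ev: "\<And>u. u < n \<Longrightarrow> (\<Sum>v\<in>{0..<n}. of_bool ((u, v) \<in> parcs G) * g v) = \<mu> * g u"
      and nz: "u0 < n" "g u0 \<noteq> 0" for \<mu> g u0
  proof (rule mem_eigenvalues_desc[OF M])
    show "vec n g \<noteq> 0\<^sub>v n" using nz by (metis index_vec index_zero_vec(1))
    show "?M *\<^sub>v vec n g = \<mu> \<cdot>\<^sub>v vec n g"
    proof (rule eq_vecI)
      fix u assume "u < dim_vec (\<mu> \<cdot>\<^sub>v vec n g)"
      hence u: "u < n" by simp
      have "(?M *\<^sub>v vec n g) $ u = (\<Sum>v\<in>{0..<n}. of_bool ((u, v) \<in> parcs G) * g v)"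
        using u by (simp add: adjacency_matrix_def scalar_prod_def of_bool_def)
      thus "(?M *\<^sub>v vec n g) $ u = (\<mu> \<cdot>\<^sub>v vec n g) $ u" using ev[OF u] u by simp
    qed (simp add: adjacency_matrix_def)
  qed simp
  have "min \<mu>1 \<mu>2 \<le> rev (sorted_list_of_multiset (proots (char_poly ?M))) ! 1"
    using less by (intro second_of_sorted_desc mem[OF ev1 nz1] mem[OF ev2 nz2]) auto
  thus ?thesis using less by (simp add: second_eigenvalue_def eigenvalues_desc_def)
qed

lemma edge_count_eq_sum:
  assumes "A \<subseteq> {0..<n}" "B \<subseteq> {0..<n}"
  shows "edge_count n G A B = (\<Sum>u\<in>A. \<Sum>v\<in>B. of_bool ((u, v) \<in> parcs G))"
proof -
  have "edge_count n G A B = (\<Sum>u\<in>{0..<n}. (if u \<in> A then 1 else 0)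
      * (\<Sum>v\<in>{0..<n}. (if (u, v) \<in> parcs G then 1 else 0) * (if v \<in> B then 1 else 0)))"
    by (simp add: edge_count_def indicator_vec_def adjacency_matrix_def scalar_prod_def)
  also have "\<dots> = (\<Sum>u\<in>{0..<n}. if u \<in> A then (\<Sum>v\<in>{0..<n}. if v \<in> B then of_bool ((u, v) \<in> parcs G) else 0) else 0)"
    by (intro sum.cong refl) (auto intro!: sum.cong)
  also have "\<dots> = (\<Sum>u\<in>{0..<n} \<inter> A. \<Sum>v\<in>{0..<n} \<inter> B. of_bool ((u, v) \<in> parcs G))"
    by (simp only: sum.inter_restrict finite_atLeastLessThan)
  finally show ?thesis using assms by (simp add: Int_absorb1)
qed

lemma regular_graph_onI:
  assumes sub: "R \<subseteq> {0..<n} \<times> {0..<n}" and irr: "\<And>u. (u, u) \<notin> R"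
    and sym: "\<And>u v. (u, v) \<in> R \<Longrightarrow> (v, u) \<in> R"
    and deg: "\<And>u. u < n \<Longrightarrow> (\<Sum>v\<in>{0..<n}. of_bool ((u, v) \<in> R) :: real) = real d"
  shows "regular_graph_on n d \<lparr>pverts = {0..<n}, parcs = R\<rparr>"
proof -
  let ?G = "\<lparr>pverts = {0..<n}, parcs = R\<rparr>"
  have fin: "finite R" using sub by (rule finite_subset) simp
  have "symmetric (with_proj ?G)"
    using sym by (auto simp: symmetric_def arcs_ends_def arc_to_ends_def intro!: symI)
  hence "pair_graph ?G"
    using sub irr fin by unfold_locales auto
  moreover have "out_degree (with_proj ?G) u = d" if u: "u < n" for u
  proof -
    have "out_arcs (with_proj ?G) u = Pair u ` {v \<in> {0..<n}. (u, v) \<in> R}"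
      using sub by (auto simp: out_arcs_def)
    hence "out_degree (with_proj ?G) u = card {v \<in> {0..<n}. (u, v) \<in> R}"
      by (simp add: out_degree_def card_image inj_on_def)
    moreover have "(\<Sum>v\<in>{0..<n}. of_bool ((u, v) \<in> R) :: real) = real (card {v \<in> {0..<n}. (u, v) \<in> R})"
      by (simp add: of_bool_def sum.If_cases Int_def)
    ultimately show ?thesis using deg[OF u] by simp
  qed
  ultimately show ?thesis by (simp add: regular_graph_on_def graph_on_def)
qed

section \<open>The planted eigenvector\<close>

lemma card_fibres_le:
  assumes m: "m > 0" and C: "C \<subseteq> {0..<f * m}"
  shows "card {u \<in> C. P (u div m)} \<le> card {x \<in> {0..<f}. P x} * m"
proof -
  have "{u \<in> C. P (u div m)} \<subseteq> (\<Union>x\<in>{x \<in> {0..<f}. P x}. {u. u div m = x})"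
    using C div_less_fibres by force
  hence "card {u \<in> C. P (u div m)} \<le> card (\<Union>x\<in>{x \<in> {0..<f}. P x}. {u. u div m = x})"
    using finite_fibre[OF m] by (intro card_mono) auto
  also have "\<dots> \<le> (\<Sum>x\<in>{x \<in> {0..<f}. P x}. card {u. u div m = x})"
    by (rule card_UN_le) auto
  finally show ?thesis by (simp add: card_fibre[OF m])
qed

text \<open>\<open>Kt\<close> keeps the entries of \<open>W\<close> positive, \<open>dens\<close>
  feeds the union bound, and \<open>gap\<close> puts the planted eigenvalue below \<open>d\<close>.
  The remainder \<open>r\<close> goes on the diagonal to make the degree exact. The error terms come
  from randomness, the rank-one part, the diagonal and the fibre corrections, in this order.\<close>

lemma ex_planted_graph:
  fixes d s t K r k :: nat
  defines "f \<equiv> fibre_count s"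
  assumes d: "d = t * f + r" and Kt: "K * 4 ^ s < t"
    and dens: "real (t + K * 4 ^ s + r + 1) \<le> 11/10 * real d / real f"
    and gap: "2 * K * (s + 1) * 4 ^ s < t * f"
  obtains n G where "n \<ge> k" "n \<ge> 2" "regular_graph_on n d G"
    "\<And>A B. A \<subseteq> {0..<n} \<Longrightarrow> B \<subseteq> {0..<n} \<Longrightarrow>
      \<bar>edge_count n G A B - real d * real (card A) * real (card B) / real n\<bar>
        \<le> (6 * sqrt (real d) + 16 * real K * 4 ^ s + real r + 1) * sqrt (real (card A) * real (card B))"
    "second_eigenvalue n G \<ge> real (2 * K * (s + 1) * 4 ^ s + r)"
proof -
  obtain lev :: "nat \<Rightarrow> nat" and sg :: "nat \<Rightarrow> int" where
    lev: "\<And>x. x < f \<Longrightarrow> lev x \<le> s"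
    and sg: "\<And>x. sg x = 1 \<or> sg x = - 1"
    and level_card: "\<And>i. i \<le> s \<Longrightarrow> card {x \<in> {0..<f}. lev x = i} = 2 * 4 ^ (s - i)"
    and sum_g0: "(\<Sum>x\<in>{0..<f}. sg x * 2 ^ lev x) = 0"
    and sum_4: "(\<Sum>x\<in>{0..<f}. 4 ^ lev x :: nat) = 2 * (s + 1) * 4 ^ s"
    unfolding f_def by (rule ex_signed_levels[of s]) blast
  define gi where "gi x = sg x * 2 ^ lev x" for x
  define g where "g x = real_of_int (gi x)" for x
  define D where "D = t + K * 4 ^ s + r + 1"
  \<comment> \<open>The product of signed weights can be negative, hence integers; \<open>Kt\<close>
    ensures that \<open>nat\<close> does not truncate for fibres below \<open>f\<close>.\<close>
  define W where "W x y = nat (int t + int K * (gi x * gi y) + int r * of_bool (x = y))" for x y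
  \<comment> \<open>All numbers of cells are at most \<open>D\<close> and so divide
    \<open>fact D\<close>; the factor \<open>k + 1\<close> makes the graph large.\<close>
  define m where "m = (k + 1) * fact D"
  have f2: "f \<ge> 2" using fibre_count_bounds(1)[of s] one_le_power[of "4::nat" s] unfolding f_def by linarith
  have abs_g: "\<bar>g x\<bar> = 2 ^ lev x" for x using sg[of x] by (auto simp: g_def gi_def abs_mult)
  have sq_g: "g x * g x = 4 ^ lev x" for x
    using sg[of x] by (auto simp: g_def gi_def power_mult_distrib[symmetric])
  have abs_prod: "\<bar>gi x * gi y\<bar> \<le> 4 ^ s" if "x < f" "y < f" for x y
  proof -
    have "\<bar>gi x * gi y\<bar> = 2 ^ lev x * 2 ^ lev y" using sg[of x] sg[of y] by (auto simp: gi_def abs_mult)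
    also have "\<dots> \<le> 2 ^ s * 2 ^ s" using lev that by (intro mult_mono power_increasing) auto
    finally show ?thesis by (simp add: power_mult_distrib[symmetric])
  qed
  have KB: "\<bar>int K * (gi x * gi y)\<bar> \<le> int (K * 4 ^ s)" if "x < f" "y < f" for x y
    using mult_left_mono[OF abs_prod[OF that], of "int K"] by (simp add: abs_mult)
  have Kt': "int (K * 4 ^ s) < int t" using Kt by (simp only: of_nat_less_iff)
  have W_int: "int (W x y) = int t + int K * (gi x * gi y) + int r * of_bool (x = y)" if "x < f" "y < f" for x y
  proof -
    have "int r * of_bool (x = y) \<ge> 0" by simp
    thus ?thesis using KB[OF that] Kt' unfolding W_def abs_le_iff by (intro nat_0_le) linarith
  qed
  have W_real: "real (W x y) = real t + real K * (g x * g y) + real r * of_bool (x = y)" if "x < f" "y < f" for x y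
  proof -
    have "real_of_int (int (W x y)) = real t + real K * (g x * g y) + real r * of_bool (x = y)"
      unfolding W_int[OF that] by (simp add: g_def)
    thus ?thesis by simp
  qed
  have W_pos: "W x y > 0" if "x < f" "y < f" for x y
  proof -
    have "int r * of_bool (x = y) \<ge> 0" by simp
    hence "int (W x y) > 0" using KB[OF that] Kt' unfolding W_int[OF that] abs_le_iff by linarith
    thus ?thesis by simp
  qed
  have W_le: "W x y + 1 \<le> D" if "x < f" "y < f" for x y
  proof -
    have "int (W x y) + 1 \<le> int D" using KB[OF that] unfolding W_int[OF that] D_def by (auto simp: abs_le_iff)
    thus ?thesis by linarith
  qed
  interpret weighted_fibres f m W
  proof
    show "m > 0" by (simp add: m_def)
    show "W x y = W y x" for x y by (simp add: W_def mult.commute eq_commute)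
    show "W x y > 0" if "x < f" "y < f" for x y by (rule W_pos[OF that])
    show "W x y + of_bool (x = y) dvd m" if "x < f" "y < f" for x y
      unfolding m_def using W_pos[OF that] W_le[OF that] by (intro dvd_mult dvd_fact) auto
  qed
  define n where "n = f * m"
  have m1: "m \<ge> k + 1" unfolding m_def using mult_le_mono2[of 1 "fact D" "k + 1"] fact_ge_1[of D] by simp
  have n: "n \<ge> k" "n \<ge> 2" unfolding n_def using f2 m1 mult_le_mono[of 2 f "k + 1" m] by auto
  have row_sum: "(\<Sum>y\<in>{0..<f}. real (W x y)) = real d" if x: "x < f" for x
  proof -
    have "(\<Sum>y\<in>{0..<f}. real (W x y)) = (\<Sum>y\<in>{0..<f}. real t + real K * g x * g y + (if y = x then real r else 0))"
      using W_real x by (intro sum.cong) (auto simp: mult_ac)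
    also have "\<dots> = real t * real f + real K * g x * (\<Sum>y\<in>{0..<f}. g y) + real r"
      using x by (simp add: sum.distrib sum_distrib_left)
    also have "(\<Sum>y\<in>{0..<f}. g y) = real_of_int (\<Sum>y\<in>{0..<f}. gi y)" by (simp add: g_def)
    also have "\<dots> = 0" unfolding gi_def sum_g0 by simp
    finally show ?thesis by (simp add: d)
  qed
  have eigen: "(\<Sum>y\<in>{0..<f}. real (W x y) * g y) = real (2 * K * (s + 1) * 4 ^ s + r) * g x" if x: "x < f" for x
  proof -
    have "(\<Sum>y\<in>{0..<f}. real (W x y) * g y) = (\<Sum>y\<in>{0..<f}. real t * g y + real K * g x * 4 ^ lev y + (if y = x then real r * g x else 0))"
      using W_real x by (intro sum.cong) (auto simp: sq_g[symmetric] algebra_simps)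
    also have "\<dots> = real t * (\<Sum>y\<in>{0..<f}. g y) + real K * g x * real (\<Sum>y\<in>{0..<f}. 4 ^ lev y) + real r * g x"
      using x by (simp add: sum.distrib sum_distrib_left)
    also have "(\<Sum>y\<in>{0..<f}. g y) = real_of_int (\<Sum>y\<in>{0..<f}. gi y)" by (simp add: g_def)
    also have "\<dots> = 0" unfolding gi_def sum_g0 by simp
    finally show ?thesis unfolding sum_4 by (simp add: algebra_simps)
  qed
  have rows: "(\<Sum>v\<in>{0..<f * m}. density u v) = real d" if "u < f * m" for u
    using sum_density_fibre_function[OF that, of "\<lambda>_. 1"] row_sum[OF div_less_fibres[OF that]] by simp
  have dens_le: "density u v \<le> 11/10 * real d / real (f * m)" if uv: "u < f * m" "v < f * m" for u v
  proof -
    have "density u v \<le> (real (W (u div m) (v div m)) + 1) / real m"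
      unfolding density_eq[OF uv] by (simp add: add_divide_distrib)
    also have "\<dots> \<le> real D / real m"
      using W_le[OF div_less_fibres[OF uv(1)] div_less_fibres[OF uv(2)]] by (intro divide_right_mono) linarith+
    also have "\<dots> \<le> (11/10 * real d / real f) / real m"
      using dens unfolding D_def by (intro divide_right_mono) auto
    finally show ?thesis by simp
  qed
  obtain \<omega> where \<omega>: "\<omega> \<in> outcomes"
    and dev: "\<And>A B. A \<subseteq> {0..<n} \<Longrightarrow> B \<subseteq> {0..<n} \<Longrightarrow>
      \<bar>arc_count \<omega> A B - mean_count A B\<bar> \<le> 6 * sqrt (real d) * sqrt (real (card A) * real (card B))"
    using ex_outcome_small_deviation[OF _ rows dens_le] unfolding n_def by auto
  define G where "G = \<lparr>pverts = {0..<n}, parcs = arcs_of \<omega>\<rparr>"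
  have arcs_fun: "(\<Sum>v\<in>{0..<n}. of_bool ((u, v) \<in> parcs G) * h (v div m)) = (\<Sum>y\<in>{0..<f}. real (W (u div m) y) * h y)"
    if "u < n" for u h
    using sum_arcs_fibre_function[OF \<omega>, of u h] that by (simp add: G_def n_def)
  have x_lt: "u div m < f" if "u < n" for u using that by (simp add: n_def div_less_fibres)
  have reg: "regular_graph_on n d G"
    unfolding G_def
  proof (rule regular_graph_onI)
    show "arcs_of \<omega> \<subseteq> {0..<n} \<times> {0..<n}" using arcs_of_subset[OF \<omega>] by (simp add: n_def)
    show "(\<Sum>v\<in>{0..<n}. of_bool ((u, v) \<in> arcs_of \<omega>) :: real) = real d" if "u < n" for u
      using arcs_fun[OF that, of "\<lambda>_. 1"] row_sum[OF x_lt[OF that]] by (simp add: G_def)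
  qed (use arcs_of_irrefl[OF \<omega>] arcs_of_sym in blast)+
  have eig: "second_eigenvalue n G \<ge> real (2 * K * (s + 1) * 4 ^ s + r)"
  proof (rule second_eigenvalue_ge[where ?\<mu>1.0 = "real d" and ?g1.0 = "\<lambda>_. 1" and ?g2.0 = "\<lambda>u. g (u div m)" and ?u1.0 = 0 and ?u2.0 = 0])
    show "(\<Sum>v\<in>{0..<n}. of_bool ((u, v) \<in> parcs G) * 1) = real d * 1" if "u < n" for u
      using arcs_fun[OF that, of "\<lambda>_. 1"] row_sum[OF x_lt[OF that]] by simp
    show "(\<Sum>v\<in>{0..<n}. of_bool ((u, v) \<in> parcs G) * g (v div m)) = real (2 * K * (s + 1) * 4 ^ s + r) * g (u div m)"
      if "u < n" for u
      using arcs_fun[OF that, of g] eigen[OF x_lt[OF that]] by simp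
    show "g (0 div m) \<noteq> 0" using abs_g[of "0 div m"] by auto
    show "real (2 * K * (s + 1) * 4 ^ s + r) < real d"
      using gap unfolding d of_nat_less_iff by simp
  qed (use n in auto)
  have jumb: "\<bar>edge_count n G A B - real d * real (card A) * real (card B) / real n\<bar>
        \<le> (6 * sqrt (real d) + 16 * real K * 4 ^ s + real r + 1) * sqrt (real (card A) * real (card B))"
    if AB: "A \<subseteq> {0..<n}" "B \<subseteq> {0..<n}" for A B
  proof -
    let ?a = "real (card A)" and ?b = "real (card B)"
    let ?q = "sqrt (?a * ?b)"
    define GA where "GA C = (\<Sum>u\<in>C. g (u div m))" for C
    define S where "S = (\<Sum>u\<in>A. \<Sum>v\<in>B. of_bool (u div m = v div m) / real m)"
    have AB': "A \<subseteq> {0..<f * m}" "B \<subseteq> {0..<f * m}" using AB by (simp_all add: n_def)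
    have mpos: "real m > 0" using m_pos by simp
    have GA: "\<bar>GA C\<bar> \<le> 4 * 2 ^ s * sqrt (real m * real (card C))" if C: "C \<subseteq> {0..<f * m}" for C
    proof -
      have "\<bar>GA C\<bar> \<le> (\<Sum>u\<in>C. \<bar>g (u div m)\<bar>)" unfolding GA_def by (rule sum_abs)
      also have "\<dots> = (\<Sum>u\<in>C. 2 ^ lev (u div m))" by (simp add: abs_g)
      also have "\<dots> \<le> 4 * 2 ^ s * sqrt (real m * real (card C))"
      proof (rule sum_pow2_level_le[OF _ mpos])
        show "finite C" using C by (rule finite_subset) simp
        show "lev (u div m) \<le> s" if "u \<in> C" for u
          using that C by (intro lev div_less_fibres) auto
        show "real (card {u \<in> C. lev (u div m) = i}) \<le> 2 * 4 ^ (s - i) * real m" if "i \<le> s" for i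
        proof -
          have "card {u \<in> C. lev (u div m) = i} \<le> 2 * 4 ^ (s - i) * m"
            using card_fibres_le[OF m_pos C, of "\<lambda>x. lev x = i"] level_card[OF that] by simp
          hence "real (card {u \<in> C. lev (u div m) = i}) \<le> real (2 * 4 ^ (s - i) * m)" by (simp only: of_nat_le_iff)
          thus ?thesis by simp
        qed
      qed
      finally show ?thesis .
    qed
    have "(\<Sum>u\<in>A. \<Sum>v\<in>B. real (W (u div m) (v div m)) / real m)
      = (\<Sum>u\<in>A. \<Sum>v\<in>B. real t / real m + real K / real m * (g (u div m) * g (v div m)) + real r * (of_bool (u div m = v div m) / real m))"
    proof (intro sum.cong refl)
      fix u v assume "u \<in> A" "v \<in> B"
      hence "u div m < f" "v div m < f" using AB' by (auto intro!: div_less_fibres)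
      thus "real (W (u div m) (v div m)) / real m
        = real t / real m + real K / real m * (g (u div m) * g (v div m)) + real r * (of_bool (u div m = v div m) / real m)"
        by (simp add: W_real add_divide_distrib)
    qed
    also have "\<dots> = real t * ?a * ?b / real m + real K / real m * (GA A * GA B) + real r * S"
      unfolding S_def GA_def sum_product by (simp add: sum.distrib sum_distrib_left)
    finally have SW: "(\<Sum>u\<in>A. \<Sum>v\<in>B. real (W (u div m) (v div m)) / real m)
      = real t * ?a * ?b / real m + real K / real m * (GA A * GA B) + real r * S" .
    \<comment> \<open>The rank-one part splits into \<open>GA A * GA B\<close>. The two factors
      \<open>sqrt m\<close> cancel the division by \<open>m\<close>, and the two constants 4 give
      16.\<close>
    have "\<bar>real K / real m * (GA A * GA B)\<bar> = real K / real m * (\<bar>GA A\<bar> * \<bar>GA B\<bar>)"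
      by (simp add: abs_mult)
    also have "\<dots> \<le> real K / real m * ((4 * 2 ^ s * sqrt (real m * ?a)) * (4 * 2 ^ s * sqrt (real m * ?b)))"
      using GA AB' by (intro mult_left_mono mult_mono) auto
    also have "\<dots> = real K / real m * (16 * (2 ^ s * 2 ^ s) * (sqrt (real m * ?a) * sqrt (real m * ?b)))"
      by simp
    also have "sqrt (real m * ?a) * sqrt (real m * ?b) = (sqrt (real m) * sqrt (real m)) * (sqrt ?a * sqrt ?b)"
      by (simp only: real_sqrt_mult mult_ac)
    also have "\<dots> = real m * ?q"
      by (simp add: real_sqrt_mult)
    also have "real K / real m * (16 * (2 ^ s * 2 ^ s) * (real m * ?q)) = 16 * real K * 4 ^ s * ?q"
      using mpos by (simp add: power_mult_distrib[symmetric])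
    finally have rank1: "\<bar>real K / real m * (GA A * GA B)\<bar> \<le> 16 * real K * 4 ^ s * ?q" .
    have S: "0 \<le> S" "S \<le> ?q" using same_fibre_bounds[OF AB'] unfolding S_def by auto
    have rS: "0 \<le> real r * S" "real r * S \<le> real r * ?q" using S by (auto intro: mult_left_mono)
    have mean: "mean_count A B \<le> real t * ?a * ?b / real m + real K / real m * (GA A * GA B) + real r * S + S"
      "real t * ?a * ?b / real m + real K / real m * (GA A * GA B) + real r * S + S - ?q \<le> mean_count A B"
      using mean_count_bounds[OF AB'] unfolding SW S_def by auto
    \<comment> \<open>Since \<open>n = f * m\<close>, the remainder \<open>r\<close> is spread
      uniformly here but concentrated on fibres in the mean. Both contributions lie between 0 and
      \<open>r * ?q\<close>, so their difference costs only \<open>r * ?q\<close>.\<close>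
    have base: "real d * ?a * ?b / real n = real t * ?a * ?b / real m + real r * (?a * ?b / real n)"
      using mpos f2 by (simp add: d n_def field_simps)
    have "?a * ?b / real n \<le> min ?a ?b"
    proof -
      have "?a \<le> real n" "?b \<le> real n" using card_mono[OF _ AB(1)] card_mono[OF _ AB(2)] by auto
      hence "min ?a ?b * max ?a ?b \<le> min ?a ?b * real n" by (intro mult_left_mono) auto
      moreover have "?a * ?b = min ?a ?b * max ?a ?b" by (simp add: min_def max_def)
      ultimately have "?a * ?b \<le> min ?a ?b * real n" by linarith
      moreover have "real n > 0" using n by simp
      ultimately show ?thesis by (intro iffD2[OF pos_divide_le_eq])
    qed
    also have "\<dots> \<le> ?q" by (rule min_le_sqrt_mult) auto
    finally have "real r * (?a * ?b / real n) \<le> real r * ?q" by (rule mult_left_mono) simp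
    moreover have "0 \<le> real r * (?a * ?b / real n)" by simp
    ultimately have rr: "0 \<le> real r * (?a * ?b / real n)" "real r * (?a * ?b / real n) \<le> real r * ?q"
      by blast+
    have "\<bar>mean_count A B - real d * ?a * ?b / real n\<bar> \<le> 16 * real K * 4 ^ s * ?q + real r * ?q + ?q"
      using mean rank1 rS rr S unfolding base abs_le_iff by linarith
    moreover have "edge_count n G A B = arc_count \<omega> A B"
      unfolding edge_count_eq_sum[OF AB] by (simp add: arc_count_def G_def)
    ultimately have "\<bar>edge_count n G A B - real d * ?a * ?b / real n\<bar>
        \<le> 6 * sqrt (real d) * ?q + (16 * real K * 4 ^ s * ?q + real r * ?q + ?q)"
      using dev[OF AB] by linarith
    thus ?thesis by (simp add: distrib_right)
  qed
  show ?thesis by (rule that[OF n reg jumb eig])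
qed

section \<open>Choice of the parameters\<close>

lemma ex_power4_bracket:
  fixes x :: real
  assumes "x \<ge> 1"
  obtains s where "4 ^ s \<le> x" "x < 4 ^ (s + 1)"
proof -
  obtain n where "x < 4 ^ n" using real_arch_pow[of 4 x] by auto
  from ex_least_nat_le[of "\<lambda>n. x < 4 ^ n", OF this]
  obtain k where k: "x < 4 ^ k" "\<And>i. i < k \<Longrightarrow> \<not> x < 4 ^ i" by blast
  from k(1) assms obtain s where s: "k = s + 1" by (cases k) auto
  show ?thesis using that[of s] k(1) k(2)[of s] unfolding s by simp
qed

text \<open>The discrepancy budget is \<open>6/7 * \<alpha>\<close> for randomness,
  \<open>\<alpha> / 14\<close> for the rank-one part and \<open>\<alpha> / 91\<close> for
  \<open>r + 1\<close>. The threshold 1225 is the square of 35, so that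
  \<open>\<alpha> \<ge> 245\<close>.\<close>

lemma ex_planting_parameters:
  fixes d :: nat and \<alpha> :: real
  assumes d: "d \<ge> 1225" and \<alpha>: "7 * sqrt (real d) < \<alpha>" "\<alpha> < real d"
  obtains s t K r where "d = t * fibre_count s + r" "K * 4 ^ s < t"
    "real (t + K * 4 ^ s + r + 1) \<le> 11/10 * real d / real (fibre_count s)"
    "2 * K * (s + 1) * 4 ^ s < t * fibre_count s"
    "6 * sqrt (real d) + 16 * real K * 4 ^ s + real r + 1 \<le> \<alpha>"
    "1/2000 * \<alpha> * (ln (real d / \<alpha>) + 1) \<le> real (2 * K * (s + 1) * 4 ^ s + r)"
proof -
  have "sqrt (real d) \<ge> 35" using d by (intro real_le_rsqrt) simp
  hence \<alpha>245: "\<alpha> \<ge> 245" using \<alpha> by linarith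
  have "(7 * sqrt (real d))\<^sup>2 \<le> \<alpha>\<^sup>2" using \<alpha> by (intro power_mono) auto
  hence "49 * real d \<le> \<alpha> * \<alpha>" by (simp add: power_mult_distrib power2_eq_square[of \<alpha>])
  hence d_le: "real d / \<alpha> \<le> \<alpha> / 49" using \<alpha>245 by (simp add: field_simps)
  \<comment> \<open>The maximum with 1 covers \<open>d < 5 * \<alpha>\<close>, where
    \<open>s = 0\<close>. Both of its arguments are at most \<open>\<alpha> / 245\<close>, the
    second because \<open>49 * d \<le> \<alpha> * \<alpha>\<close>.\<close>
  obtain s where s: "4 ^ s \<le> max 1 (real d / (5 * \<alpha>))" "max 1 (real d / (5 * \<alpha>)) < 4 ^ (s + 1)"
    by (rule ex_power4_bracket[of "max 1 (real d / (5 * \<alpha>))"]) auto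
  define p :: real where "p = 4 ^ s"
  \<comment> \<open>As \<open>p \<le> \<alpha> / 245\<close>, the quotient exceeds 1 and rounding
    down loses at most a factor 2.\<close>
  define K where "K = nat \<lfloor>\<alpha> / (224 * p)\<rfloor>"
  define f where "f = fibre_count s"
  define t where "t = d div f"
  define r where "r = d mod f"
  have p1: "p \<ge> 1" unfolding p_def by simp
  have ps: "real (s + 1) \<le> p"
  proof -
    have "s + 1 \<le> (4::nat) ^ s" by (induction s) auto
    hence "real (s + 1) \<le> real (4 ^ s)" by (simp only: of_nat_le_iff)
    thus ?thesis by (simp add: p_def)
  qed
  have p245: "p \<le> \<alpha> / 245"
  proof -
    have "real d / (5 * \<alpha>) = real d / \<alpha> / 5" by simp
    thus ?thesis using s(1) d_le \<alpha>245 unfolding p_def by linarith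
  qed
  have f_bounds: "2 * p \<le> real f" "3 * real f \<le> 8 * p"
  proof -
    have "real (2 * 4 ^ s) \<le> real f" "real (3 * f) \<le> real (8 * 4 ^ s)"
      unfolding f_def of_nat_le_iff by (rule fibre_count_bounds)+
    thus "2 * p \<le> real f" "3 * real f \<le> 8 * p" by (simp_all add: p_def)
  qed
  \<comment> \<open>For \<open>p = 1\<close> the estimate \<open>f \<le> 8/3\<close> must be
    sharpened to 2 by integrality, since only \<open>\<alpha> < d\<close> is at hand there.\<close>
  have f\<alpha>: "real f * \<alpha> \<le> 2 * real d"
  proof (cases "real d / (5 * \<alpha>) \<le> 1")
    case True
    hence "p \<le> 1" using s(1) by (simp add: p_def max_def split: if_splits)
    hence "3 * real f \<le> 8" using f_bounds by linarith
    hence "f \<le> 2" by linarith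
    hence "real f \<le> 2" by simp
    hence "real f * \<alpha> \<le> 2 * \<alpha>" using \<alpha>245 by (intro mult_right_mono) auto
    thus ?thesis using \<alpha> by linarith
  next
    case False
    hence "p \<le> real d / (5 * \<alpha>)" using s(1) by (simp add: p_def max_def split: if_splits)
    hence "p * \<alpha> \<le> real d / 5" using \<alpha>245 by (simp add: field_simps)
    moreover have "3 * real f * \<alpha> \<le> 8 * p * \<alpha>" using f_bounds \<alpha>245 by (intro mult_right_mono) auto
    ultimately show ?thesis by linarith
  qed
  have f0: "f > 0" using f_bounds p1 by (cases f) auto
  have df: "\<alpha> / 2 \<le> real d / real f" using f\<alpha> f0 by (simp add: field_simps)
  have Kp: "real K * p \<le> \<alpha> / 224" "real K * p \<ge> \<alpha> / 448"
  proof -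
    define x where "x = \<alpha> / (224 * p)"
    have x: "x \<ge> 1" using p245 p1 \<alpha>245 by (simp add: x_def field_simps)
    have xp: "x * p = \<alpha> / 224" using p1 by (simp add: x_def)
    have K: "real K \<le> x" "real K \<ge> x / 2"
    proof -
      have "real (nat \<lfloor>x\<rfloor>) = real_of_int \<lfloor>x\<rfloor>" "real_of_int \<lfloor>x\<rfloor> \<ge> 1" using x by simp_all
      thus "real K \<le> x" "real K \<ge> x / 2" unfolding K_def x_def[symmetric] by linarith+
    qed
    show "real K * p \<le> \<alpha> / 224" using mult_right_mono[OF K(1), of p] p1 xp by simp
    show "real K * p \<ge> \<alpha> / 448" using mult_right_mono[OF K(2), of p] p1 xp by simp
  qed
  have dtr: "d = t * f + r" by (simp add: t_def r_def)
  have "r + 1 \<le> f" using f0 by (simp add: r_def Suc_le_eq)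
  hence rf: "real r + 1 \<le> real f" by linarith
  hence r_le: "real r + 1 \<le> \<alpha> / 91" using f_bounds p245 by linarith
  have d_real: "real d = real t * real f + real r" by (simp add: dtr)
  have "real d / real f = real t + real r / real f" using f0 by (simp add: d_real add_divide_distrib)
  moreover have "0 \<le> real r / real f" "real r / real f \<le> 1" using rf f0 by (auto simp: divide_le_eq)
  ultimately have t_bounds: "real t \<le> real d / real f" "\<alpha> / 3 \<le> real t" using df \<alpha>245 by linarith+
  have Kp': "real (K * 4 ^ s) = real K * p" by (simp add: p_def)
  have lam: "real (2 * K * (s + 1) * 4 ^ s) = 2 * (real K * p) * real (s + 1)"
    by (simp add: p_def algebra_simps)
  show ?thesis
  proof (rule that[of t s r K])
    show "d = t * fibre_count s + r" using dtr by (simp add: f_def)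
    have "real (K * 4 ^ s) < real t" using Kp Kp' t_bounds \<alpha>245 by linarith
    thus "K * 4 ^ s < t" by (simp only: of_nat_less_iff)
    have "real (t + K * 4 ^ s + r + 1) = real t + real K * p + (real r + 1)" using Kp' by simp
    \<comment> \<open>As \<open>d / f\<close> is at least \<open>\<alpha> / 2\<close>, the permitted
      surplus is at least \<open>\<alpha> / 20\<close>, more than
      \<open>\<alpha> / 224 + \<alpha> / 91\<close>.\<close>
    also have "\<dots> \<le> 11/10 * (real d / real f)" using t_bounds(1) Kp r_le df \<alpha>245 by linarith
    finally show "real (t + K * 4 ^ s + r + 1) \<le> 11/10 * real d / real (fibre_count s)" by (simp add: f_def)
    have "real (2 * K * (s + 1) * 4 ^ s) \<le> 2 * (\<alpha> / 224) * p"
      unfolding lam using Kp ps p1 \<alpha>245 by (intro mult_mono) auto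
    also have "\<dots> < \<alpha> / 3 * (2 * p)" using \<alpha>245 p1 by simp
    also have "\<dots> \<le> real t * real f" using t_bounds f_bounds \<alpha>245 p1 by (intro mult_mono) auto
    finally have "real (2 * K * (s + 1) * 4 ^ s) < real (t * f)" by simp
    thus "2 * K * (s + 1) * 4 ^ s < t * fibre_count s" unfolding of_nat_less_iff f_def .
    have "16 * real K * 4 ^ s = 16 * (real K * p)" by (simp add: p_def)
    thus "6 * sqrt (real d) + 16 * real K * 4 ^ s + real r + 1 \<le> \<alpha>"
      using Kp r_le \<alpha> \<alpha>245 by linarith
    \<comment> \<open>The upper end of the bracket bounds the logarithm by a multiple of
      \<open>s + 1\<close>: with the added 1 the total is at most \<open>8 * (s + 1)\<close>, and
      \<open>8 / 2000 \<le> 2 / 448\<close>.\<close>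
    have "real d / \<alpha> \<le> 5 * 4 ^ (s + 1)" using s(2) \<alpha>245 by (simp add: field_simps)
    hence "ln (real d / \<alpha>) \<le> ln (5 * 4 ^ (s + 1))" using \<alpha> \<alpha>245 by (subst ln_le_cancel_iff) auto
    also have "\<dots> = ln 5 + real (s + 1) * ln 4" by (simp add: ln_mult ln_realpow del: power_Suc)
    also have "\<dots> \<le> 4 + real (s + 1) * 3"
      using ln_le_minus_one[of 5] ln_le_minus_one[of 4] by (intro add_mono mult_left_mono) auto
    finally have "1/2000 * \<alpha> * (ln (real d / \<alpha>) + 1) \<le> 1/2000 * \<alpha> * (8 * real (s + 1))"
      using \<alpha>245 by (intro mult_left_mono) auto
    also have "\<dots> \<le> 2 * (\<alpha> / 448) * real (s + 1)" using \<alpha>245 by simp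
    also have "\<dots> \<le> 2 * (real K * p) * real (s + 1)" using Kp by (intro mult_right_mono) auto
    also have "\<dots> \<le> real (2 * K * (s + 1) * 4 ^ s + r)" unfolding of_nat_add lam by simp
    finally show "1/2000 * \<alpha> * (ln (real d / \<alpha>) + 1) \<le> real (2 * K * (s + 1) * 4 ^ s + r)" .
  qed
qed

theorem theorem5p1:
  shows "\<exists>(c::real) > 0. \<exists>d0::nat. \<forall>d \<ge> d0. \<forall>\<alpha>::real.
           7 * sqrt (real d) < \<alpha> \<and> \<alpha> < real d \<longrightarrow>
             (\<forall>N::nat. \<exists>n \<ge> N. \<exists>G. n \<ge> 2 \<and> jumbled n d \<alpha> G \<and>
                second_eigenvalue n G \<ge> c * \<alpha> * (ln (real d / \<alpha>) + 1))"
proof (rule exI[of _ "1/2000"], rule conjI, simp, rule exI[of _ 1225], intro allI impI)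
  fix d N :: nat and \<alpha> :: real
  assume d: "d \<ge> 1225" and \<alpha>: "7 * sqrt (real d) < \<alpha> \<and> \<alpha> < real d"
  obtain s t K r where par: "d = t * fibre_count s + r" "K * 4 ^ s < t"
    "real (t + K * 4 ^ s + r + 1) \<le> 11/10 * real d / real (fibre_count s)"
    "2 * K * (s + 1) * 4 ^ s < t * fibre_count s"
    and sum_le: "6 * sqrt (real d) + 16 * real K * 4 ^ s + real r + 1 \<le> \<alpha>"
    and ev: "1/2000 * \<alpha> * (ln (real d / \<alpha>) + 1) \<le> real (2 * K * (s + 1) * 4 ^ s + r)"
    by (rule ex_planting_parameters[OF d conjunct1[OF \<alpha>] conjunct2[OF \<alpha>]])
  obtain n G where n: "n \<ge> N" "n \<ge> 2" and reg: "regular_graph_on n d G"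
    and dev: "\<And>A B. A \<subseteq> {0..<n} \<Longrightarrow> B \<subseteq> {0..<n} \<Longrightarrow>
      \<bar>edge_count n G A B - real d * real (card A) * real (card B) / real n\<bar>
        \<le> (6 * sqrt (real d) + 16 * real K * 4 ^ s + real r + 1) * sqrt (real (card A) * real (card B))"
    and ev': "second_eigenvalue n G \<ge> real (2 * K * (s + 1) * 4 ^ s + r)"
    by (rule ex_planted_graph[OF par, of N]) blast
  have "pverts G = {0..<n}" using reg by (simp add: regular_graph_on_def graph_on_def)
  moreover have "\<bar>edge_count n G A B - real d * real (card A) * real (card B) / real n\<bar>
      \<le> \<alpha> * sqrt (real (card A) * real (card B))" if "A \<subseteq> {0..<n}" "B \<subseteq> {0..<n}" for A B
    using dev[OF that] mult_right_mono[OF sum_le, of "sqrt (real (card A) * real (card B))"]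
    by (rule order_trans) simp
  ultimately have "jumbled n d \<alpha> G" using reg by (simp add: jumbled_def)
  thus "\<exists>n\<ge>N. \<exists>G. n \<ge> 2 \<and> jumbled n d \<alpha> G \<and>
      1/2000 * \<alpha> * (ln (real d / \<alpha>) + 1) \<le> second_eigenvalue n G"
    using n order_trans[OF ev ev'] by blast
qed

end
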